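(* Let $(X,d,\mu)$ be a metric measure space with a doubling measure $\mu$, with doubling constant $c_\mu>1$ and $D=\log_2 c_\mu$. Let $1<p<\infty$, $\eta>0$, let $B_0=B(x_{B_0},r_{B_0})\subset X$ be a ball, let $\widehat{B}_0=(1+\eta)B_0$, and let $$\alpha = 5^D c_\mu^2\left(1+\frac1\eta\right)^D .$$ Let $0<s\le s_0=\min\left\{\frac{1}{2\alpha},\frac{1}{8c_\mu^3}\right\}$ and $s\le r\le \frac12$. If $f\in JN_{p,0,s}(\widehat{B}_0)$, then for every $\lambda>0$ it holds that $$\mu(\{x\in B_0: |f(x)-m_f^{r}(B_0)|>\lambda\})\le c\,\frac{\|f\|_{JN_{p,0,s}(\widehat{B}_0)}^p}{\lambda^p},$$ where the constant $c$ depends only on $p$ and the doubling constant $c_\mu$, namely $$c=\frac{2^{p+3}c_\mu^6}{(2^{1/p}-1)^p}.$$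
   Context: Balls are $B(x,r)=\{y\in X: d(x,y)<r\}$; a ball comes with a center and radius, and $\lambda B=B(x,\lambda r)$ for $\lambda>0$. A Borel regular measure $\mu$ is doubling with constant $c_\mu>1$ if $0<\mu(2B)\le c_\mu\mu(B)<\infty$ for every ball $B$. For a set $A$ with $0<\mu(A)<\infty$, a measurable $[-\infty,\infty]$-valued function $f$ and $0<s\le 1$, the maximal $s$-median of $f$ over $A$ is $$m_f^s(A)=\inf\{a\in\mathbb{R}:\mu(\{x\in A: f(x)>a\})<s\mu(A)\}.$$ For an open set $\Omega\subset X$, $1<p<\infty$ and $0<s\le 1/2$, a measurable function $f$ belongs to $JN_{p,0,s}(\Omega)$ if $$\|f\|_{JN_{p,0,s}(\Omega)}^p=\sup\sum_{i=1}^\infty\mu(B_i)\left(\inf_{c_i\in\mathbb{R}}m_{|f-c_i|}^s(B_i)\right)^p<\infty,$$ where the supremum is over all countable collections of pairwise disjoint balls $B_i\subset\Omega$. *)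

theory Defs
  imports "HOL-Analysis.Analysis"
begin

text \<open>
  A measure on a metric space is an Isabelle measure whose sigma-algebra contains the Borel sets.
  The sigma-algebra may be larger: a Borel regular outer measure, restricted to its
  Caratheodory measurable sets, is an instance.
\<close>

definition borel_regular :: "'a::metric_space measure \<Rightarrow> bool" where
  "borel_regular M \<longleftrightarrow>
     space M = UNIV \<and> sets borel \<subseteq> sets M \<and>
     (\<forall>A\<in>sets M. \<exists>B\<in>sets borel. A \<subseteq> B \<and> emeasure M B = emeasure M A)"

definition doubling :: "'a::metric_space measure \<Rightarrow> real \<Rightarrow> bool" where
  "doubling M C \<longleftrightarrow> 1 < C \<and>
     (\<forall>x r. 0 < r \<longrightarrow>
        0 < emeasure M (ball x (2 * r)) \<and>
        emeasure M (ball x (2 * r)) \<le> ennreal C * emeasure M (ball x r) \<and>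
        ennreal C * emeasure M (ball x r) < \<infinity>)"

text \<open>
  The level \<open>a\<close> ranges over the reals, while the infimum is taken in the extended reals.
\<close>

definition max_median :: "'a measure \<Rightarrow> real \<Rightarrow> ('a \<Rightarrow> ereal) \<Rightarrow> 'a set \<Rightarrow> ereal" where
  "max_median M s f A =
     Inf {ereal a | a :: real. emeasure M {x \<in> A. f x > ereal a} < ennreal s * emeasure M A}"

text \<open>
  The library has no real powers on the extended nonnegative reals;
  the convention for positive exponents is that infinity is mapped to infinity.
\<close>

definition ennreal_powr :: "ennreal \<Rightarrow> real \<Rightarrow> ennreal" where
  "ennreal_powr x p = (if x = \<infinity> then \<infinity> else ennreal (enn2real x powr p))"

definition disjoint_balls :: "'a::metric_space set \<Rightarrow> 'a set set set" where
  "disjoint_balls \<Omega> =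
     {\<B>. countable \<B> \<and> disjoint \<B> \<and> (\<forall>B\<in>\<B>. B \<subseteq> \<Omega> \<and> (\<exists>x r. 0 < r \<and> B = ball x r))}"

text \<open>
  For \<open>0 < s \<le> 1\<close> and \<open>0 < \<mu>(B) < \<infinity>\<close> the medians of \<open>\<bar>f - c\<bar>\<close> are nonnegative,
  so \<open>e2ennreal\<close> does not truncate below.
\<close>

definition JN_sup ::
    "'a::metric_space measure \<Rightarrow> real \<Rightarrow> real \<Rightarrow> 'a set \<Rightarrow> ('a \<Rightarrow> ereal) \<Rightarrow> ennreal" where
  "JN_sup M p s \<Omega> f =
     (SUP \<B>\<in>disjoint_balls \<Omega>. \<Sum>\<^sub>\<infinity>B\<in>\<B>. emeasure M B *
        ennreal_powr (e2ennreal (INF c::real. max_median M s (\<lambda>x. \<bar>f x - ereal c\<bar>) B)) p)"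

text \<open>Functions are total in HOL; only the values of \<open>f\<close> on \<open>\<Omega>\<close> matter here.\<close>

definition JN_space ::
    "'a::metric_space measure \<Rightarrow> real \<Rightarrow> real \<Rightarrow> 'a set \<Rightarrow> ('a \<Rightarrow> ereal) set" where
  "JN_space M p s \<Omega> =
     {f. f \<in> borel_measurable (restrict_space M \<Omega>) \<and> JN_sup M p s \<Omega> f < \<infinity>}"

text \<open>Real-valued, hence meaningful only for members of \<open>JN_space\<close>, where the supremum is finite.\<close>

definition JN_norm ::
    "'a::metric_space measure \<Rightarrow> real \<Rightarrow> real \<Rightarrow> 'a set \<Rightarrow> ('a \<Rightarrow> ereal) \<Rightarrow> real" where
  "JN_norm M p s \<Omega> f = enn2real (JN_sup M p s \<Omega> f) powr (1 / p)"

end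

theory Submission
  imports Defs
begin

text \<open>
The proof is a good-$\lambda$ argument in which masses of disjoint stopping balls take the place of measures
of level sets.  Write $m$ for the median of \<open>f\<close> over \<open>B\<^sub>0\<close>, let \<open>F\<^sub>l\<close> be the set where \<open>\<bar>f - m\<bar> > l\<close>, and call
a ball heavy for \<open>F\<^sub>l\<close> if \<open>F\<^sub>l\<close> fills at least half of it, and light otherwise.  For each centre in \<open>B\<^sub>0\<close> consider the radii
\<open>R / 2^k\<close> and stop at the largest one whose ball is heavy.  Let \<open>a(l)\<close> denote the largest total mass
of disjoint stopping balls at level \<open>l\<close>.  Almost every point of \<open>F\<^sub>l\<close> has a heavy ball, by a density theorem
(\<open>light_points_negligible\<close>), so a Vitali covering gives \<open>\<mu>(F\<^sub>l \<inter> B\<^sub>0) \<le> c\<^sup>2 a(l)\<close>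
(\<open>measure_le_stopping_packing\<close>), and it remains to show that \<open>a(l)\<close> decays like \<open>l\<^sup>-\<^sup>p\<close>.

Let \<open>K = 2 powr (1/p)\<close> and compare a level \<open>l \<ge> 4 L\<close>, with \<open>L\<close> as below, with the level \<open>K l\<close>.  Every stopping ball at the higher level lies in a
concentric stopping ball \<open>Q\<close> at level \<open>l\<close>, and the enlarged ball \<open>4Q\<close> is still light for \<open>F\<^sub>l\<close>.
If, outside a portion \<open>s\<close> of \<open>4Q\<close>, the function \<open>f\<close> stays within \<open>(K - 1) l / 2\<close> of some constant, then this
constant is close to \<open>m\<close>, because \<open>4Q\<close> is light, so \<open>F\<^sub>K\<^sub>l\<close> occupies at most the portion \<open>s\<close> of \<open>4Q\<close>;
since \<open>s\<close> is small compared with \<open>c\<^sup>-\<^sup>2\<close>, the heavy balls at level \<open>K l\<close> have small total mass there.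
Otherwise \<open>4Q\<close> contributes at least \<open>\<mu>(4Q) ((K - 1) l / 2)\<^sup>p\<close> to a John--Nirenberg sum, and a Vitali selection among
the balls \<open>4Q\<close> bounds the total mass of these.  Together (\<open>stopping_packing_step\<close>),
\<open>a(K l) \<le> a(l) / 4 + c\<^sup>2 N / ((K - 1) l / 2)\<^sup>p\<close>, where \<open>N\<close> bounds the John--Nirenberg functional.  Multiplication of
\<open>l\<close> by \<open>K\<close> halves \<open>l\<^sup>-\<^sup>p\<close>, so a bound of order \<open>l\<^sup>-\<^sup>p\<close> for \<open>a(l)\<close> passes from \<open>l\<close> to \<open>K l\<close>.

The iteration starts at a level \<open>4 L\<close> with \<open>\<mu>(B\<^sub>0) L\<^sup>p = N\<close>.  Both \<open>B\<^sub>0\<close> and a larger concentric ball \<open>X\<close> are admissible in the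
John--Nirenberg functional, so \<open>f\<close> is within \<open>L\<close> of a constant on most of either; these constants and \<open>m\<close>
are close to each other.  The set \<open>F\<^sub>4\<^sub>L\<close> is therefore so small in \<open>X\<close> that the two largest
balls around points of \<open>B\<^sub>0\<close> are light, which is what the smallness of \<open>s\<close> provides.  This makes
\<open>4Q\<close> one of the balls examined before stopping.  Below \<open>4 L\<close> the claim holds because the right-hand side is at least \<open>\<mu>(B\<^sub>0)\<close>.
\<close>

section \<open>Selection of disjoint sets\<close>

text \<open>
The usual greedy choice by size, made in one step by Zorn's lemma: sizes are measured by a natural number rank
(small rank for a large set), so among the sets missed by a family there is one of least rank, and it may be added
without breaking the rule that a set met by the family is met by a member of no larger rank.  Comparing ranks
exactly, instead of up to a factor, lets three-fold enlargements cover.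
\<close>

lemma vitali_selection:
  fixes B :: "'i \<Rightarrow> 'a set" and k :: "'i \<Rightarrow> nat"
  assumes nonempty: "\<And>t. t \<in> T \<Longrightarrow> B t \<noteq> {}"
  obtains S where "S \<subseteq> T" "disjoint_family_on B S"
    "\<And>t. t \<in> T \<Longrightarrow> \<exists>s\<in>S. k s \<le> k t \<and> B s \<inter> B t \<noteq> {}"
proof -
  define Q where "Q = {S. S \<subseteq> T \<and> disjoint_family_on B S \<and>
    (\<forall>t\<in>T. (\<exists>s\<in>S. B s \<inter> B t \<noteq> {}) \<longrightarrow> (\<exists>s\<in>S. k s \<le> k t \<and> B s \<inter> B t \<noteq> {}))}"
  have "\<exists>S\<in>Q. \<forall>X\<in>Q. S \<subseteq> X \<longrightarrow> X = S"
  proof (rule subset_Zorn_nonempty)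
    show "Q \<noteq> {}" by (auto simp: Q_def disjoint_family_on_def)
  next
    fix \<C> assume ne: "\<C> \<noteq> {}" and ch: "subset.chain Q \<C>"
    have sub: "\<C> \<subseteq> Q" using ch by (auto simp: subset.chain_def)
    have "disjoint_family_on B (\<Union>\<C>)"
      unfolding disjoint_family_on_def
    proof (intro ballI impI)
      fix s t assume "s \<in> \<Union>\<C>" "t \<in> \<Union>\<C>" and st: "s \<noteq> t"
      then obtain S S' where S: "S \<in> \<C>" "s \<in> S" "S' \<in> \<C>" "t \<in> S'" by auto
      then have "S \<subseteq> S' \<or> S' \<subseteq> S"
        using ch by (auto simp: subset.chain_def)
      then obtain S'' where "S'' \<in> \<C>" "s \<in> S''" "t \<in> S''" using S by blast
      then show "B s \<inter> B t = {}" using sub st by (auto simp: Q_def disjoint_family_on_def)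
    qed
    moreover have "\<exists>s\<in>\<Union>\<C>. k s \<le> k t \<and> B s \<inter> B t \<noteq> {}"
      if "t \<in> T" and ex: "\<exists>s\<in>\<Union>\<C>. B s \<inter> B t \<noteq> {}" for t
    proof -
      obtain S where S: "S \<in> \<C>" "\<exists>s\<in>S. B s \<inter> B t \<noteq> {}" using ex by blast
      then have "\<exists>s\<in>S. k s \<le> k t \<and> B s \<inter> B t \<noteq> {}"
        using sub \<open>t \<in> T\<close> unfolding Q_def by blast
      then show ?thesis using S by blast
    qed
    moreover have "\<Union>\<C> \<subseteq> T" using sub by (auto simp: Q_def)
    ultimately show "\<Union>\<C> \<in> Q" unfolding Q_def by blast
  qed
  then obtain S where S: "S \<in> Q" and max: "\<And>X. X \<in> Q \<Longrightarrow> S \<subseteq> X \<Longrightarrow> X = S" by blast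
  have meets: "\<exists>s\<in>S. B s \<inter> B t \<noteq> {}" if t: "t \<in> T" for t
  proof (rule ccontr)
    assume neg: "\<not> ?thesis"
    define P where "P = (\<lambda>n. \<exists>u\<in>T. k u = n \<and> (\<forall>s\<in>S. B s \<inter> B u = {}))"
    have "P (k t)" using t neg by (auto simp: P_def)
    then have "P (LEAST n. P n)" by (rule LeastI)
    then obtain u where u: "u \<in> T" "k u = (LEAST n. P n)" "\<forall>s\<in>S. B s \<inter> B u = {}"
      by (auto simp: P_def)
    have least: "k u \<le> k v" if "v \<in> T" "\<forall>s\<in>S. B s \<inter> B v = {}" for v
      unfolding u(2) by (rule Least_le) (use that in \<open>auto simp: P_def\<close>)
    have "insert u S \<in> Q"
    proof -
      have "disjoint_family_on B (insert u S)"
        using S u(3) by (auto simp: Q_def disjoint_family_on_def)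
      moreover have "\<exists>s\<in>insert u S. k s \<le> k v \<and> B s \<inter> B v \<noteq> {}"
        if v: "v \<in> T" "\<exists>s\<in>insert u S. B s \<inter> B v \<noteq> {}" for v
      proof (cases "\<exists>s\<in>S. B s \<inter> B v \<noteq> {}")
        case True
        then show ?thesis using S v(1) unfolding Q_def by blast
      next
        case False
        then show ?thesis using v least[OF v(1)] by blast
      qed
      ultimately show ?thesis using S u(1) unfolding Q_def by blast
    qed
    then have "u \<in> S" using max by blast
    then show False using u nonempty by blast
  qed
  show thesis
    by (rule that[of S]) (use S meets in \<open>auto simp: Q_def\<close>)
qed

section \<open>Outer regularity\<close>

text \<open>
The sets that can be squeezed between a closed and an open set form a sigma-algebra: for complements exchange the
roles, for countable unions truncate the union of the closed sets.  Closed sets belong to it because they are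
intersections of their shrinking neighbourhoods.  Finiteness of the measure enters through the set \<open>X\<close>.
\<close>

lemma finite_measure_borel_approx:
  assumes borel: "sets borel \<subseteq> sets (M :: 'a::metric_space measure)"
    and X: "X \<in> fmeasurable M" and A: "A \<in> sets borel" and e: "0 < (e::real)"
  shows "\<exists>C U. closed C \<and> open U \<and> C \<subseteq> A \<and> A \<subseteq> U \<and> measure M (X \<inter> (U - C)) < e"
proof -
  have XI [intro]: "X \<inter> B \<in> fmeasurable M" if "B \<in> sets borel" for B
    using X that borel by (intro fmeasurableI2[OF X]) (auto dest: fmeasurableD)
  have XS: "X \<inter> B \<in> sets M" if "B \<in> sets borel" for B
    using XI[OF that] by (rule fmeasurableD)
  have "A \<in> sigma_sets UNIV (Collect closed)"
    using A unfolding borel_eq_closed by simp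
  then show ?thesis using e
  proof (induction arbitrary: e)
    case (Basic A)
    then have cl: "closed A" by simp
    show ?case
    proof (cases "A = {}")
      case True
      then show ?thesis using Basic by (intro exI[of _ "{}"]) auto
    next
      case False
      define U where "U n = {x. infdist x A < 1 / real (Suc n)}" for n
      have opU: "open (U n)" for n
        unfolding U_def by (intro open_Collect_less continuous_intros)
      have "(\<lambda>n. measure M (X \<inter> (U n - A))) \<longlonglongrightarrow> measure M (\<Inter>n. X \<inter> (U n - A))"
      proof (rule Lim_measure_decseq)
        show "range (\<lambda>n. X \<inter> (U n - A)) \<subseteq> sets M"
          using opU cl XI by (auto intro!: fmeasurableD)
        have "U n \<subseteq> U m" if "m \<le> n" for m n
          unfolding U_def using that by (auto elim!: less_le_trans intro!: frac_le)
        then show "decseq (\<lambda>n. X \<inter> (U n - A))"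
          by (fastforce simp: antimono_def)
        show "emeasure M (X \<inter> (U n - A)) \<noteq> \<infinity>" for n
          using XI[of "U n - A"] opU cl by (auto simp: fmeasurable_def)
      qed
      moreover have "(\<Inter>n. X \<inter> (U n - A)) = {}"
      proof -
        have "infdist x A = 0" if "\<forall>n. x \<in> U n" for x
        proof (rule ccontr)
          assume "infdist x A \<noteq> 0"
          then have "0 < infdist x A" using infdist_nonneg[of x A] by simp
          then obtain n where "inverse (real (Suc n)) < infdist x A"
            using reals_Archimedean by blast
          then show False using that[rule_format, of n] by (simp add: U_def field_simps)
        qed
        then show ?thesis
          using in_closed_iff_infdist_zero[OF cl False] by auto
      qed
      ultimately have "(\<lambda>n. measure M (X \<inter> (U n - A))) \<longlonglongrightarrow> 0" by simp
      then have "\<forall>\<^sub>F n in sequentially. measure M (X \<inter> (U n - A)) < e"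
        using Basic by (intro order_tendstoD) auto
      then obtain n where "measure M (X \<inter> (U n - A)) < e"
        by (meson eventually_happens sequentially_bot)
      moreover have "A \<subseteq> U n" by (auto simp: U_def)
      ultimately show ?thesis using opU cl by blast
    qed
  next
    case Empty
    then show ?case by (intro exI[of _ "{}"]) auto
  next
    case (Compl A)
    from Compl.IH[OF Compl.prems] obtain C U where
      "closed C" "open U" "C \<subseteq> A" "A \<subseteq> U" "measure M (X \<inter> (U - C)) < e" by blast
    moreover have "- C - (- U) = U - C" by auto
    ultimately show ?case
      by (intro exI[of _ "- U"] exI[of _ "- C"]) (auto simp: Compl_eq_Diff_UNIV[symmetric])
  next
    case (Union A)
    have "\<forall>n. \<exists>C U. closed C \<and> open U \<and> C \<subseteq> A n \<and> A n \<subseteq> U \<and>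
        measure M (X \<inter> (U - C)) < e / 2 * (1/2) ^ Suc n"
      using Union.prems by (intro allI Union.IH) simp
    then obtain C U where CU: "\<And>n. closed (C n)" "\<And>n. open (U n)" "\<And>n. C n \<subseteq> A n"
        "\<And>n. A n \<subseteq> U n" "\<And>n. measure M (X \<inter> (U n - C n)) < e / 2 * (1/2) ^ Suc n"
      by metis
    have [measurable]: "C n \<in> sets borel" "U n \<in> sets borel" for n using CU by auto
    have fin_bound: "measure M (\<Union>n\<in>I. X \<inter> (U n - C n)) \<le> e / 2" if fin: "finite I" for I
    proof -
      have half: "(\<lambda>n. e / 2 * (1/2) ^ Suc n) sums (e / 2)"
        using sums_mult[OF power_half_series, of "e/2"] by simp
      have "measure M (\<Union>n\<in>I. X \<inter> (U n - C n)) \<le> (\<Sum>n\<in>I. measure M (X \<inter> (U n - C n)))"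
        by (intro measure_UNION_le fin XS) auto
      also have "\<dots> \<le> (\<Sum>n\<in>I. e / 2 * (1/2) ^ Suc n)"
        using CU(5) by (intro sum_mono less_imp_le)
      also have "\<dots> \<le> (\<Sum>n. e / 2 * (1/2) ^ Suc n)"
        using half Union.prems fin by (intro sum_le_suminf) (auto simp: sums_iff)
      also have "\<dots> = e / 2" using half by (simp add: sums_iff)
      finally show ?thesis .
    qed
    have first: "(\<Union>n. X \<inter> (U n - C n)) \<in> fmeasurable M"
        "measure M (\<Union>n. X \<inter> (U n - C n)) \<le> e / 2"
      by (rule fmeasurable_UN_bound[OF countableI_type _ fin_bound];
          use XI in simp)
        (rule measure_UN_bound[OF countableI_type _ fin_bound]; use XI in simp)
    \<comment> \<open>A countable union of closed sets need not be closed; a finite part of it already has almost the same measure in \<open>X\<close>.\<close>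
    have tailfm: "X \<inter> ((\<Union>n. C n) - (\<Union>n<m. C n)) \<in> fmeasurable M" for m
      by (intro XI) measurable
    have "(\<lambda>m. measure M (X \<inter> ((\<Union>n. C n) - (\<Union>n<m. C n)))) \<longlonglongrightarrow>
        measure M (\<Inter>m. X \<inter> ((\<Union>n. C n) - (\<Union>n<m. C n)))"
    proof (rule Lim_measure_decseq)
      show "range (\<lambda>m. X \<inter> ((\<Union>n. C n) - (\<Union>n<m. C n))) \<subseteq> sets M"
        using fmeasurableD[OF tailfm] by blast
      show "decseq (\<lambda>m. X \<inter> ((\<Union>n. C n) - (\<Union>n<m. C n)))"
        by (intro antimonoI Int_mono Diff_mono UN_mono) auto
    qed (use fmeasurableD2[OF tailfm] in simp)
    moreover have "x \<notin> (\<Inter>m. X \<inter> ((\<Union>n. C n) - (\<Union>n<m. C n)))" for x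
    proof
      assume x: "x \<in> (\<Inter>m. X \<inter> ((\<Union>n. C n) - (\<Union>n<m. C n)))"
      then obtain n where "x \<in> C n" by blast
      moreover have "x \<notin> (\<Union>i<Suc n. C i)" using x by blast
      ultimately show False by blast
    qed
    then have "(\<Inter>m. X \<inter> ((\<Union>n. C n) - (\<Union>n<m. C n))) = {}" by blast
    ultimately have "(\<lambda>m. measure M (X \<inter> ((\<Union>n. C n) - (\<Union>n<m. C n)))) \<longlonglongrightarrow> 0" by simp
    then have "\<forall>\<^sub>F m in sequentially. measure M (X \<inter> ((\<Union>n. C n) - (\<Union>n<m. C n))) < e / 2"
      using Union.prems by (intro order_tendstoD) auto
    then obtain m where m: "measure M (X \<inter> ((\<Union>n. C n) - (\<Union>n<m. C n))) < e / 2"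
      by (meson eventually_happens sequentially_bot)
    have "measure M (X \<inter> ((\<Union>n. U n) - (\<Union>n<m. C n))) \<le>
      measure M ((\<Union>n. X \<inter> (U n - C n)) \<union> X \<inter> ((\<Union>n. C n) - (\<Union>n<m. C n)))"
    proof (rule measure_mono_fmeasurable)
      show "X \<inter> ((\<Union>n. U n) - (\<Union>n<m. C n)) \<in> sets M"
        by (intro XS) measurable
      show "(\<Union>n. X \<inter> (U n - C n)) \<union> X \<inter> ((\<Union>n. C n) - (\<Union>n<m. C n)) \<in> fmeasurable M"
        by (rule fmeasurable.Un[OF first(1) tailfm])
    qed blast
    also have "\<dots> \<le> measure M (\<Union>n. X \<inter> (U n - C n)) + measure M (X \<inter> ((\<Union>n. C n) - (\<Union>n<m. C n)))"
      by (rule measure_Un_le[OF fmeasurableD[OF first(1)] fmeasurableD[OF tailfm]])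
    also have "\<dots> < e" using first m by simp
    finally have small: "measure M (X \<inter> ((\<Union>n. U n) - (\<Union>n<m. C n))) < e" .
    have "closed (\<Union>n<m. C n)" using CU(1) by (intro closed_UN) auto
    moreover have "open (\<Union>n. U n)" using CU(2) by (intro open_UN) auto
    moreover have "(\<Union>n<m. C n) \<subseteq> (\<Union>n. A n)" using CU(3) by blast
    moreover have "(\<Union>n. A n) \<subseteq> (\<Union>n. U n)" using CU(4) by blast
    ultimately show ?case using small by blast
  qed
qed

lemma sum_measure_disjoint_le:
  assumes fin: "finite S" and disj: "disjoint_family_on A S" and W: "W \<in> fmeasurable M"
    and A: "\<And>s. s \<in> S \<Longrightarrow> A s \<in> sets M" "\<And>s. s \<in> S \<Longrightarrow> A s \<subseteq> W"
  shows "(\<Sum>s\<in>S. measure M (A s)) \<le> measure M W"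
proof -
  have fm: "A s \<in> fmeasurable M" if "s \<in> S" for s
    using A that W by (blast intro: fmeasurableI2)
  have "(\<Sum>s\<in>S. measure M (A s)) = measure M (\<Union>s\<in>S. A s)"
    using fin disj A fm by (intro measure_finite_Union[symmetric]) (auto dest: fmeasurableD2)
  also have "\<dots> \<le> measure M W"
    using A fin W by (intro measure_mono_fmeasurable) auto
  finally show ?thesis .
qed

section \<open>Dyadic balls and stopping radii\<close>

text \<open>
The index pair is kept, not just the set: a ball of a metric space determines neither its centre nor its radius,
and the selection needs the rank \<open>snd s\<close>.
\<close>

definition dyadic_ball :: "real \<Rightarrow> 'a::metric_space \<times> nat \<Rightarrow> 'a set" where
  "dyadic_ball R s = ball (fst s) (R / 2 ^ snd s)"

lemma dyadic_ball_nonempty: "0 < R \<Longrightarrow> dyadic_ball R s \<noteq> {}"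
  by (auto simp: dyadic_ball_def not_le)

lemma center_in_dyadic_ball: "0 < R \<Longrightarrow> fst s \<in> dyadic_ball R s"
  by (simp add: dyadic_ball_def)

lemma dyadic_ball_mono: "R \<le> R' \<Longrightarrow> dyadic_ball R s \<subseteq> dyadic_ball R' s"
  unfolding dyadic_ball_def by (intro subset_ball divide_right_mono) auto

lemma dyadic_ball_antimono: "0 < R \<Longrightarrow> k \<le> l \<Longrightarrow> dyadic_ball R (x, l) \<subseteq> dyadic_ball R (x, k)"
  unfolding dyadic_ball_def by (auto intro!: subset_ball divide_left_mono)

lemma dyadic_ball_coarser: "dyadic_ball (4 * R) (x, k + 2) = dyadic_ball R (x, k)"
  by (simp add: dyadic_ball_def)

text \<open>
Three times the larger radius already suffices; four is the next power of two, for which doubling gives the factor \<open>c\<^sup>2\<close>.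
\<close>

lemma dyadic_ball_engulf:
  assumes R: "0 < R" and rank: "snd s \<le> snd t" and meet: "dyadic_ball R s \<inter> dyadic_ball R t \<noteq> {}"
  shows "dyadic_ball R t \<subseteq> dyadic_ball (4 * R) s"
proof
  fix y assume y: "y \<in> dyadic_ball R t"
  have le: "R / 2 ^ snd t \<le> R / 2 ^ snd s"
    using R rank by (intro divide_left_mono) auto
  obtain z where z: "z \<in> dyadic_ball R s" "z \<in> dyadic_ball R t" using meet by auto
  have "dist (fst s) y \<le> dist (fst s) z + dist z (fst t) + dist (fst t) y"
    using dist_triangle[of "fst s" y z] dist_triangle[of z y "fst t"] by simp
  also have "\<dots> < R / 2 ^ snd s + R / 2 ^ snd t + R / 2 ^ snd t"
    using y z by (intro add_strict_mono) (auto simp: dyadic_ball_def dist_commute)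
  also have "\<dots> \<le> 4 * R / 2 ^ snd s"
  proof -
    have "0 \<le> R / 2 ^ snd s" using R by simp
    then show ?thesis using le unfolding times_divide_eq_right[symmetric] by linarith
  qed
  finally show "y \<in> dyadic_ball (4 * R) s" by (simp add: dyadic_ball_def)
qed

text \<open>
Upper bounds for the supremum \<open>a(l)\<close> of the introduction.  Finite families suffice for the recursion between levels, and they
keep all sums real; countable families are reached by exhaustion.
\<close>

definition packing_bound :: "'a::metric_space measure \<Rightarrow> real \<Rightarrow> ('a \<times> nat) set \<Rightarrow> real \<Rightarrow> bool" where
  "packing_bound M R T b \<longleftrightarrow>
     (\<forall>S. finite S \<longrightarrow> S \<subseteq> T \<longrightarrow> disjoint_family_on (dyadic_ball R) S \<longrightarrow>
        (\<Sum>s\<in>S. measure M (dyadic_ball R s)) \<le> b)"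

lemma packing_boundD:
  "packing_bound M R T b \<Longrightarrow> finite S \<Longrightarrow> S \<subseteq> T \<Longrightarrow> disjoint_family_on (dyadic_ball R) S \<Longrightarrow>
    (\<Sum>s\<in>S. measure M (dyadic_ball R s)) \<le> b"
  by (auto simp: packing_bound_def)

lemma packing_bound_mono: "packing_bound M R T b \<Longrightarrow> T' \<subseteq> T \<Longrightarrow> b \<le> b' \<Longrightarrow> packing_bound M R T' b'"
  unfolding packing_bound_def by (meson order_trans)

lemma packing_bound_nonneg: "packing_bound M R T b \<Longrightarrow> 0 \<le> b"
  by (drule packing_boundD[where S="{}"]) (auto simp: disjoint_family_on_def)

definition heavy :: "'a::metric_space measure \<Rightarrow> real \<Rightarrow> 'a set \<Rightarrow> 'a \<times> nat \<Rightarrow> bool" where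
  "heavy M R F s \<longleftrightarrow> measure M (dyadic_ball R s) \<le> 2 * measure M (F \<inter> dyadic_ball R s)"

text \<open>
Calderon--Zygmund stopping balls: with respect to the centre, all larger dyadic balls are light.
\<close>

definition stopping :: "'a::metric_space measure \<Rightarrow> real \<Rightarrow> 'a set \<Rightarrow> 'a set \<Rightarrow> ('a \<times> nat) set" where
  "stopping M R A F = {(x, k). x \<in> A \<and> heavy M R F (x, k) \<and> (\<forall>l<k. \<not> heavy M R F (x, l))}"

lemma stopping_below_heavy:
  assumes "x \<in> A" "heavy M R F (x, l)"
  obtains k where "k \<le> l" "(x, k) \<in> stopping M R A F"
proof -
  define k where "k = (LEAST k. heavy M R F (x, k))"
  have "heavy M R F (x, k)" unfolding k_def using assms(2) by (rule LeastI)
  moreover have "k \<le> l" unfolding k_def using assms(2) by (rule Least_le)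
  moreover have "\<not> heavy M R F (x, i)" if "i < k" for i
    using that not_less_Least unfolding k_def by blast
  ultimately show thesis using that assms(1) by (auto simp: stopping_def)
qed

section \<open>Two elementary estimates for real parameters\<close>

text \<open>
Lets the initial term \<open>4 powr p\<close> be absorbed by the main term of the final constant.  The left-hand side is
\<open>(2 (K - 1)) powr p\<close> with \<open>K = 2 powr (1/p)\<close>: for \<open>p \<le> 2\<close> the base is at most 2, for \<open>p > 2\<close> it is at most 1.
\<close>

lemma shifted_root_powr_le_4:
  assumes p: "1 < (p::real)" shows "2 powr p * (2 powr (1 / p) - 1) powr p \<le> 4"
proof -
  define k where "k = (2::real) powr (1 / p)"
  have k: "1 < k" using p by (simp add: k_def)
  have eq: "2 powr p * (k - 1) powr p = (2 * (k - 1)) powr p"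
    by (simp only: powr_mult)
  have "(2 * (k - 1)) powr p \<le> 4"
  proof (cases "p \<le> 2")
    case True
    have "k \<le> 2 powr 1" unfolding k_def using p by (intro powr_mono) auto
    then have "(2 * (k - 1)) powr p \<le> 2 powr p"
      using k p by (intro powr_mono2) auto
    also have "\<dots> \<le> 2 powr 2" using True by (intro powr_mono) auto
    finally show ?thesis by simp
  next
    case False
    have "k \<le> 2 powr (1 / 2)" unfolding k_def using False by (intro powr_mono) (auto simp: field_simps)
    also have "\<dots> = sqrt 2" by (simp add: powr_half_sqrt)
    also have "\<dots> \<le> 3 / 2" by (rule real_le_lsqrt) (auto simp: power2_eq_square)
    finally have "(2 * (k - 1)) powr p \<le> 1 powr p"
      using k p by (intro powr_mono2) auto
    then show ?thesis by simp
  qed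
  then show ?thesis using eq by (simp add: k_def)
qed

text \<open>
The number \<open>j\<close> counts the doublings that make a ball of radius \<open>h r\<^sub>0 / 2\<close> around a point of \<open>B(x\<^sub>0, r\<^sub>0)\<close> contain
\<open>B(x\<^sub>0, (1 + h) r\<^sub>0)\<close>, where \<open>h = min \<eta> 1\<close>.  For \<open>\<eta> \<ge> 1\<close> three doublings do, and the bound \<open>s \<le> 1 / (8 c\<^sup>3)\<close> is used.  For
\<open>\<eta> < 1\<close> the least such \<open>j\<close> has \<open>2 ^ j \<le> 4 * 5 * (1 + 1 / \<eta>)\<close>, and raising this to the power \<open>D\<close> gives \<open>c ^ j \<le> \<alpha>\<close>.  Replacing \<open>\<eta>\<close> by
\<open>h\<close> keeps \<open>B(x\<^sub>0, (1 + h) r\<^sub>0)\<close> inside the double of \<open>B(x\<^sub>0, r\<^sub>0)\<close>.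
\<close>

lemma doubling_exponent_choice:
  assumes c: "1 < c" and D: "D = log 2 c" and \<eta>: "0 < (\<eta>::real)"
    and s: "0 < s" "s \<le> 1 / (2 * (5 powr D * c ^ 2 * (1 + 1 / \<eta>) powr D))" "s \<le> 1 / (8 * c ^ 3)"
  obtains j where "4 + 2 * min \<eta> 1 \<le> 2 ^ j * min \<eta> 1" "s * c ^ j \<le> 1 / 2"
proof (cases "1 \<le> \<eta>")
  case True
  have "s * c ^ 3 \<le> 1 / 8" using s(3) c by (simp add: field_simps)
  then show thesis using True by (intro that[of 3]) auto
next
  case False
  define j where "j = nat \<lceil>log 2 (2 + 4 / \<eta>)\<rceil>"
  have y: "1 < 2 + 4 / \<eta>" using \<eta> by (simp add: add_pos_pos)
  then have j0: "0 \<le> log 2 (2 + 4 / \<eta>)" by simp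
  have "2 + 4 / \<eta> = 2 powr (log 2 (2 + 4 / \<eta>))" using y by simp
  also have "\<dots> \<le> 2 powr j" unfolding j_def using j0 by (intro powr_mono) linarith+
  finally have low: "2 + 4 / \<eta> \<le> 2 ^ j" by (simp add: powr_realpow)
  have "(2::real) powr j \<le> 2 powr (log 2 (2 + 4 / \<eta>) + 1)"
    unfolding j_def using j0 by (intro powr_mono) linarith+
  also have "\<dots> = 2 * (2 + 4 / \<eta>)" using y by (simp add: powr_add)
  also have "\<dots> \<le> 4 * 5 * (1 + 1 / \<eta>)" using \<eta> by (simp add: field_simps)
  finally have up: "(2::real) powr j \<le> 4 * 5 * (1 + 1 / \<eta>)" .
  have D0: "0 < D" using c D by simp
  have cD: "c = 2 powr D" using c D by simp
  have "c ^ j = (2 powr j) powr D"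
    using c by (simp add: powr_realpow[symmetric] cD powr_powr mult.commute)
  also have "\<dots> \<le> (4 * 5 * (1 + 1 / \<eta>)) powr D" using up D0 by (intro powr_mono2) auto
  also have "\<dots> = 4 powr D * 5 powr D * (1 + 1 / \<eta>) powr D" by (simp only: powr_mult)
  also have "4 powr D = c ^ 2" by (simp add: cD power2_eq_square flip: powr_mult)
  finally have "c ^ j \<le> 5 powr D * c ^ 2 * (1 + 1 / \<eta>) powr D" by (simp add: mult_ac)
  then have "s * c ^ j \<le> s * (5 powr D * c ^ 2 * (1 + 1 / \<eta>) powr D)"
    using s by (intro mult_left_mono) auto
  also have "\<dots> \<le> 1 / 2"
  proof -
    have "0 < 5 powr D * c ^ 2 * (1 + 1 / \<eta>) powr D"
      using c add_pos_pos[OF zero_less_one divide_pos_pos[OF zero_less_one \<eta>]] by auto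
    then show ?thesis using s(2) by (simp add: field_simps)
  qed
  finally show thesis using low \<eta> False by (intro that[of j]) (auto simp: field_simps)
qed

section \<open>Recentering deviations\<close>

text \<open>
Some point of \<open>B\<close> avoids both exceptional sets, and the value of \<open>f\<close> there is finite and close to both constants.
\<close>

lemma common_center:
  assumes B: "B \<in> fmeasurable M"
    and P: "{x \<in> B. \<bar>f x - ereal q\<bar> > ereal a} \<in> sets M" and Q: "{x \<in> B. \<bar>f x - ereal q'\<bar> > ereal a'} \<in> sets M"
    and less: "measure M {x \<in> B. \<bar>f x - ereal q\<bar> > ereal a} + measure M {x \<in> B. \<bar>f x - ereal q'\<bar> > ereal a'} < measure M B"
  shows "\<bar>q - q'\<bar> \<le> a + a'"
proof -
  let ?P = "{x \<in> B. \<bar>f x - ereal q\<bar> > ereal a}" and ?Q = "{x \<in> B. \<bar>f x - ereal q'\<bar> > ereal a'}"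
  have "measure M (?P \<union> ?Q) < measure M B"
    using measure_Un_le[OF P Q] less by linarith
  then have "?P \<union> ?Q \<noteq> B" by auto
  then obtain x where "x \<in> B" "x \<notin> ?P" "x \<notin> ?Q" by blast
  then have "\<bar>f x - ereal q\<bar> \<le> ereal a" "\<bar>f x - ereal q'\<bar> \<le> ereal a'" by auto
  then show ?thesis by (cases "f x") auto
qed

lemma deviation_recenter:
  assumes "\<bar>q - q'\<bar> + a \<le> b"
  shows "{x \<in> B. \<bar>f x - ereal q\<bar> > ereal b} \<subseteq> {x \<in> B. \<bar>f x - ereal q'\<bar> > ereal a}"
proof safe
  fix x assume "ereal b < \<bar>f x - ereal q\<bar>"
  then show "ereal a < \<bar>f x - ereal q'\<bar>" using assms by (cases "f x") auto
qed

section \<open>Covering and density for doubling measures\<close>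

locale doubling_measure =
  fixes M :: "'a::metric_space measure" and c :: real
  assumes regular: "borel_regular M" and doubling: "doubling M c"
begin

lemma space_eq [simp]: "space M = UNIV" and borel_sets: "sets borel \<subseteq> sets M"
  using regular by (auto simp: borel_regular_def)

lemma c_gt_1: "1 < c" using doubling by (simp add: doubling_def)

lemma ball_fmeasurable [simp]: "ball x r \<in> fmeasurable M"
proof (cases "0 < r")
  case True
  then have "ennreal c * emeasure M (ball x r) < \<infinity>" using doubling by (simp add: doubling_def)
  then have "emeasure M (ball x r) < \<infinity>" using c_gt_1
    by (auto simp: ennreal_mult_less_top less_top[symmetric] ennreal_eq_0_iff)
  then show ?thesis using borel_sets by (auto intro!: fmeasurableI)
qed (simp add: ball_empty)

lemma ball_sets [simp]: "ball x r \<in> sets M"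
  by (rule fmeasurableD) simp

lemma dyadic_ball_fmeasurable [simp]: "dyadic_ball R s \<in> fmeasurable M"
  by (simp add: dyadic_ball_def)

lemma dyadic_ball_sets [simp]: "dyadic_ball R s \<in> sets M"
  by (simp add: dyadic_ball_def)

lemma measure_ball_double:
  assumes "0 < r" shows "measure M (ball x (2 * r)) \<le> c * measure M (ball x r)"
proof -
  have "emeasure M (ball x (2 * r)) \<le> ennreal c * emeasure M (ball x r)"
    using doubling assms by (simp add: doubling_def)
  then show ?thesis using c_gt_1
    by (simp add: emeasure_eq_measure2 ennreal_mult[symmetric])
qed

lemma measure_ball_pos:
  assumes "0 < r" shows "0 < measure M (ball x r)"
proof -
  have "0 < emeasure M (ball x (2 * (r / 2)))"
    using doubling assms unfolding doubling_def by (meson half_gt_zero)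
  then show ?thesis by (simp add: emeasure_eq_measure2)
qed

lemma measure_ball_pow2:
  assumes "0 < r" shows "measure M (ball x (2 ^ j * r)) \<le> c ^ j * measure M (ball x r)"
proof (induction j)
  case (Suc j)
  have "measure M (ball x (2 ^ Suc j * r)) \<le> c * measure M (ball x (2 ^ j * r))"
    using measure_ball_double[of "2 ^ j * r" x] assms by (simp add: mult.assoc)
  also have "\<dots> \<le> c * (c ^ j * measure M (ball x r))"
    using Suc c_gt_1 by (intro mult_left_mono) auto
  finally show ?case by simp
qed simp

lemma measure_dyadic_ball_pos: "0 < R \<Longrightarrow> 0 < measure M (dyadic_ball R s)"
  by (simp add: dyadic_ball_def measure_ball_pos)

lemma measure_dyadic_ball_enlarge:
  assumes "0 < R" shows "measure M (dyadic_ball (4 * R) s) \<le> c\<^sup>2 * measure M (dyadic_ball R s)"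
  using measure_ball_pow2[of "R / 2 ^ snd s" "fst s" 2] assms by (simp add: dyadic_ball_def)

text \<open>
The Vitali covering lemma in the form needed here: the selected family is countable because its finite
subfamilies have bounded mass and no ball is null.
\<close>

lemma packing_bound_cover:
  assumes R: "0 < R" and bound: "packing_bound M R T b"
  obtains W where "W \<in> fmeasurable M" "fst ` T \<subseteq> W" "measure M W \<le> c\<^sup>2 * b"
proof -
  obtain S where S: "S \<subseteq> T" "disjoint_family_on (dyadic_ball R) S"
    and sel: "\<And>t. t \<in> T \<Longrightarrow> \<exists>s\<in>S. snd s \<le> snd t \<and> dyadic_ball R s \<inter> dyadic_ball R t \<noteq> {}"
    using vitali_selection[of T "dyadic_ball R" snd] dyadic_ball_nonempty[OF R] by metis
  have fin: "(\<Sum>s\<in>S'. measure M (dyadic_ball R s)) \<le> b" if "finite S'" "S' \<subseteq> S" for S'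
    using packing_boundD[OF bound] that S by (meson disjoint_family_on_mono order_trans)
  have "(\<lambda>s. measure M (dyadic_ball R s)) summable_on S"
    by (rule nonneg_bdd_above_summable_on) (use fin in \<open>auto intro!: bdd_aboveI2\<close>)
  from summable_countable_real[OF this] have count: "countable S"
    using measure_dyadic_ball_pos[OF R] by (simp add: less_imp_neq[THEN not_sym])
  define W where "W = (\<Union>s\<in>S. dyadic_ball (4 * R) s)"
  have le: "measure M (\<Union>s\<in>S'. dyadic_ball (4 * R) s) \<le> c\<^sup>2 * b" if "finite S'" "S' \<subseteq> S" for S'
  proof -
    have "measure M (\<Union>s\<in>S'. dyadic_ball (4 * R) s) \<le> (\<Sum>s\<in>S'. measure M (dyadic_ball (4 * R) s))"
      using that by (intro measure_UNION_le) auto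
    also have "\<dots> \<le> (\<Sum>s\<in>S'. c\<^sup>2 * measure M (dyadic_ball R s))"
      by (intro sum_mono measure_dyadic_ball_enlarge R)
    also have "\<dots> \<le> c\<^sup>2 * b"
      using fin[OF that] by (simp add: sum_distrib_left[symmetric] mult_left_mono)
    finally show ?thesis .
  qed
  show thesis
  proof (rule that[of W])
    show "W \<in> fmeasurable M" "measure M W \<le> c\<^sup>2 * b"
      unfolding W_def
      by (rule fmeasurable_UN_bound[OF count dyadic_ball_fmeasurable le]; assumption)
        (rule measure_UN_bound[OF count dyadic_ball_fmeasurable le]; assumption)
    show "fst ` T \<subseteq> W"
    proof
      fix x assume "x \<in> fst ` T"
      then obtain t where t: "t \<in> T" "x = fst t" by auto
      obtain s where s: "s \<in> S" "snd s \<le> snd t" "dyadic_ball R s \<inter> dyadic_ball R t \<noteq> {}"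
        using sel[OF t(1)] by auto
      then have "x \<in> dyadic_ball (4 * R) s"
        using dyadic_ball_engulf[OF R s(2,3)] center_in_dyadic_ball[OF R, of t] t(2) by blast
      then show "x \<in> W" using s(1) by (auto simp: W_def)
    qed
  qed
qed

lemma open_superset_approx:
  assumes F: "F \<in> sets M" "F \<subseteq> ball z q" and e: "0 < e"
  obtains U where "open U" "F \<subseteq> U" "U - F \<in> fmeasurable M" "measure M (U - F) < e"
proof -
  obtain B where B: "B \<in> sets borel" "F \<subseteq> B" "emeasure M B = emeasure M F"
    using regular F(1) by (auto simp: borel_regular_def)
  have Ffm: "F \<in> fmeasurable M" using F by (blast intro: fmeasurableI2 ball_fmeasurable)
  have Bfm: "B \<in> fmeasurable M"
    using B Ffm borel_sets by (auto simp: fmeasurable_def)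
  \<comment> \<open>Zero, because \<open>B\<close> is a Borel hull of \<open>F\<close> and \<open>F\<close> has finite measure.\<close>
  have "measure M (B - F) = measure M B - measure M F"
    using B F(1) Bfm by (intro measure_Diff) (auto simp: fmeasurable_def)
  also have "\<dots> = 0" using B by (simp add: measure_def)
  finally have BF: "measure M (B - F) = 0" .
  obtain C U where U: "open U" "B \<subseteq> U" "C \<subseteq> B" "closed C" "measure M (ball z q \<inter> (U - C)) < e"
    using finite_measure_borel_approx[OF borel_sets ball_fmeasurable[of z q] B(1) e] by blast
  have US: "U \<in> sets M" "C \<in> sets M" using U borel_sets by auto
  have fm: "U \<inter> ball z q - F \<in> fmeasurable M"
    using US F by (intro fmeasurableI2[OF ball_fmeasurable[of z q]] sets.Diff sets.Int ball_sets) auto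
  have fm': "ball z q \<inter> (U - C) \<in> fmeasurable M"
    using US by (intro fmeasurableI2[OF ball_fmeasurable[of z q]] sets.Diff sets.Int ball_sets) auto
  have "measure M (U \<inter> ball z q - F) \<le> measure M (ball z q \<inter> (U - C) \<union> (B - F))"
  proof (rule measure_mono_fmeasurable)
    show "U \<inter> ball z q - F \<subseteq> ball z q \<inter> (U - C) \<union> (B - F)" using U(3) by blast
    show "ball z q \<inter> (U - C) \<union> (B - F) \<in> fmeasurable M"
      by (rule fmeasurable.Un[OF fm' fmeasurable.Diff[OF Bfm Ffm]])
  qed (rule fmeasurableD[OF fm])
  also have "\<dots> \<le> measure M (ball z q \<inter> (U - C)) + measure M (B - F)"
    using US F B borel_sets by (intro measure_Un_le) auto
  also have "\<dots> < e" using U BF by simp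
  finally show thesis
    using that[of "U \<inter> ball z q"] fm U B F by auto
qed

text \<open>
The part of the Lebesgue density theorem that is needed.  A light ball inside an open \<open>U \<supseteq> F\<close> has at least half of
its mass in \<open>U - F\<close>, so disjoint light balls inside \<open>U\<close> have total mass at most \<open>2 \<mu>(U - F)\<close>, and the
covering lemma bounds the set of their centres.  The constant lost in the covering is harmless since \<open>\<mu>(U - F)\<close> is arbitrarily small.
\<close>

lemma light_points_negligible:
  assumes F: "F \<in> sets M" "F \<subseteq> ball z q" and R: "0 < R" and e: "0 < e"
  obtains W where "W \<in> fmeasurable M" "{x \<in> F. \<forall>k. \<not> heavy M R F (x, k)} \<subseteq> W" "measure M W \<le> e"
proof -
  define d where "d = e / (2 * c\<^sup>2)"
  have d: "0 < d" using e c_gt_1 by (simp add: d_def)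
  obtain U where U: "open U" "F \<subseteq> U" "U - F \<in> fmeasurable M" "measure M (U - F) < d"
    using open_superset_approx[OF F d] .
  define T where "T = {(x, k). x \<in> F \<and> \<not> heavy M R F (x, k) \<and> dyadic_ball R (x, k) \<subseteq> U}"
  have "packing_bound M R T (2 * d)"
    unfolding packing_bound_def
  proof (intro allI impI)
    fix S assume S: "finite S" "S \<subseteq> T" "disjoint_family_on (dyadic_ball R) S"
    have "(\<Sum>s\<in>S. measure M (dyadic_ball R s)) \<le> (\<Sum>s\<in>S. 2 * measure M (dyadic_ball R s - F))"
    proof (rule sum_mono)
      fix s assume s: "s \<in> S"
      have "measure M (dyadic_ball R s) =
          measure M (F \<inter> dyadic_ball R s) + measure M (dyadic_ball R s - F)"
      proof -
        have "F \<inter> dyadic_ball R s \<in> sets M" using F(1) by (rule sets.Int) simp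
        then have "measure M (dyadic_ball R s - F \<inter> dyadic_ball R s) =
            measure M (dyadic_ball R s) - measure M (F \<inter> dyadic_ball R s)"
          using fmeasurableD2[OF dyadic_ball_fmeasurable] by (intro measure_Diff) auto
        moreover have "dyadic_ball R s - F \<inter> dyadic_ball R s = dyadic_ball R s - F" by blast
        ultimately show ?thesis by simp
      qed
      moreover have "\<not> heavy M R F s" using s S(2) by (auto simp: T_def)
      ultimately show "measure M (dyadic_ball R s) \<le> 2 * measure M (dyadic_ball R s - F)"
        by (simp add: heavy_def)
    qed
    also have "\<dots> = 2 * (\<Sum>s\<in>S. measure M (dyadic_ball R s - F))" by (simp add: sum_distrib_left)
    also have "(\<Sum>s\<in>S. measure M (dyadic_ball R s - F)) \<le> measure M (U - F)"
    proof (rule sum_measure_disjoint_le[OF S(1) _ U(3)])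
      show "disjoint_family_on (\<lambda>s. dyadic_ball R s - F) S"
        using S(3) unfolding disjoint_family_on_def by blast
    qed (use S(2) F(1) in \<open>auto simp: T_def\<close>)
    finally show "(\<Sum>s\<in>S. measure M (dyadic_ball R s)) \<le> 2 * d" using U(4) by simp
  qed
  from packing_bound_cover[OF R this] obtain W
    where W: "W \<in> fmeasurable M" "fst ` T \<subseteq> W" "measure M W \<le> c\<^sup>2 * (2 * d)" .
  have "{x \<in> F. \<forall>k. \<not> heavy M R F (x, k)} \<subseteq> fst ` T"
  proof
    fix x assume x: "x \<in> {x \<in> F. \<forall>k. \<not> heavy M R F (x, k)}"
    then have "x \<in> U" using U(2) by blast
    then obtain r where r: "0 < r" "ball x r \<subseteq> U" using openE[OF U(1)] by blast
    obtain k where "R / r < 2 ^ k" using real_arch_pow[of 2 "R / r"] by auto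
    then have "R / 2 ^ k \<le> r" using r by (simp add: field_simps)
    then have "dyadic_ball R (x, k) \<subseteq> U"
      using r subset_ball[of "R / 2 ^ k" r x] by (auto simp: dyadic_ball_def)
    then have "(x, k) \<in> T" using x by (simp add: T_def)
    then show "x \<in> fst ` T" by (rule rev_image_eqI) simp
  qed
  moreover have "c\<^sup>2 * (2 * d) = e" using c_gt_1 by (simp add: d_def)
  ultimately show thesis using that[of W] W by auto
qed

lemma measure_le_stopping_packing:
  assumes F: "F \<in> sets M" "F \<subseteq> ball z q" and R: "0 < R" and A: "A \<in> sets M"
    and bound: "packing_bound M R (stopping M R A F) b"
  shows "measure M (F \<inter> A) \<le> c\<^sup>2 * b"
proof (rule field_le_epsilon)
  fix e :: real assume e: "0 < e"
  obtain W where W: "W \<in> fmeasurable M" "fst ` stopping M R A F \<subseteq> W" "measure M W \<le> c\<^sup>2 * b"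
    using packing_bound_cover[OF R bound] .
  obtain Z where Z: "Z \<in> fmeasurable M" "{x \<in> F. \<forall>k. \<not> heavy M R F (x, k)} \<subseteq> Z" "measure M Z \<le> e"
    using light_points_negligible[OF F R e] .
  have "F \<inter> A \<subseteq> W \<union> Z"
  proof
    fix x assume x: "x \<in> F \<inter> A"
    show "x \<in> W \<union> Z"
    proof (cases "\<exists>k. heavy M R F (x, k)")
      case True
      then obtain l where l: "heavy M R F (x, l)" by blast
      have "x \<in> A" using x by simp
      then obtain k where "(x, k) \<in> stopping M R A F"
        using l by (rule stopping_below_heavy)
      then have "x \<in> fst ` stopping M R A F" by (rule rev_image_eqI) simp
      then show ?thesis using W(2) by blast
    qed (use x Z(2) in auto)
  qed
  then have "measure M (F \<inter> A) \<le> measure M (W \<union> Z)"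
    using F A W Z by (intro measure_mono_fmeasurable fmeasurable.Un) auto
  also have "\<dots> \<le> measure M W + measure M Z"
    using W Z by (intro measure_Un_le) auto
  finally show "measure M (F \<inter> A) \<le> c\<^sup>2 * b + e" using W Z by simp
qed

section \<open>From one level to a higher one\<close>

text \<open>
Charging scheme common to both kinds of balls in the next lemma: each \<open>B s\<close> sits in a ball of the family \<open>T\<close>; a Vitali
selection from these balls engulfs every \<open>B s\<close> in a four-fold enlargement, to which it is charged.
\<close>

lemma sum_le_engulfing:
  assumes R: "0 < R" and \<kappa>: "0 \<le> \<kappa>" and fin: "finite S" and \<tau>: "\<And>s. s \<in> S \<Longrightarrow> \<tau> s \<in> T"
    and sub: "\<And>s. s \<in> S \<Longrightarrow> B s \<subseteq> dyadic_ball R (\<tau> s)"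
    and bound: "packing_bound M R T b"
    and key: "\<And>v V. v \<in> T \<Longrightarrow> V \<subseteq> S \<Longrightarrow> (\<And>s. s \<in> V \<Longrightarrow> B s \<subseteq> dyadic_ball (4 * R) v) \<Longrightarrow>
       (\<Sum>s\<in>V. measure M (B s)) \<le> \<kappa> * measure M (dyadic_ball (4 * R) v)"
  shows "(\<Sum>s\<in>S. measure M (B s)) \<le> \<kappa> * (c\<^sup>2 * b)"
proof -
  obtain V where V: "V \<subseteq> \<tau> ` S" "disjoint_family_on (dyadic_ball R) V"
    and sel: "\<And>t. t \<in> \<tau> ` S \<Longrightarrow> \<exists>v\<in>V. snd v \<le> snd t \<and> dyadic_ball R v \<inter> dyadic_ball R t \<noteq> {}"
    using vitali_selection[of "\<tau> ` S" "dyadic_ball R" snd] dyadic_ball_nonempty[OF R] by metis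
  have finV: "finite V" using V(1) fin finite_surj by blast
  have VT: "V \<subseteq> T" using V(1) \<tau> by blast
  have "\<forall>s\<in>S. \<exists>v\<in>V. B s \<subseteq> dyadic_ball (4 * R) v"
    using sel dyadic_ball_engulf[OF R] sub by (meson imageI order_trans)
  then obtain \<psi> where \<psi>: "\<And>s. s \<in> S \<Longrightarrow> \<psi> s \<in> V" "\<And>s. s \<in> S \<Longrightarrow> B s \<subseteq> dyadic_ball (4 * R) (\<psi> s)"
    by metis
  have "(\<Sum>s\<in>S. measure M (B s)) = (\<Sum>v\<in>V. \<Sum>s\<in>{s \<in> S. \<psi> s = v}. measure M (B s))"
    by (rule sum.group[symmetric]) (use fin finV \<psi> in auto)
  also have "\<dots> \<le> (\<Sum>v\<in>V. \<kappa> * (c\<^sup>2 * measure M (dyadic_ball R v)))"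
  proof (rule sum_mono)
    fix v assume v: "v \<in> V"
    have "(\<Sum>s\<in>{s \<in> S. \<psi> s = v}. measure M (B s)) \<le> \<kappa> * measure M (dyadic_ball (4 * R) v)"
      using v VT \<psi>(2) by (intro key) auto
    also have "\<dots> \<le> \<kappa> * (c\<^sup>2 * measure M (dyadic_ball R v))"
      using measure_dyadic_ball_enlarge[OF R] \<kappa> by (intro mult_left_mono)
    finally show "(\<Sum>s\<in>{s \<in> S. \<psi> s = v}. measure M (B s)) \<le> \<kappa> * (c\<^sup>2 * measure M (dyadic_ball R v))" .
  qed
  also have "\<dots> = \<kappa> * (c\<^sup>2 * (\<Sum>v\<in>V. measure M (dyadic_ball R v)))"
    by (simp add: sum_distrib_left)
  also have "\<dots> \<le> \<kappa> * (c\<^sup>2 * b)"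
    using packing_boundD[OF bound finV VT V(2)] \<kappa> by (intro mult_left_mono) auto
  finally show ?thesis .
qed

text \<open>
One step of the recursion.  The set \<open>Bad\<close> collects the balls on whose enlargement \<open>f\<close> oscillates.  Higher stopping balls in a
good one are heavy for \<open>F'\<close>, so their mass is at most twice that of \<open>F'\<close> in the enlargement, which accounts
for the factor \<open>2 \<sigma> c\<^sup>2\<close>.  In a bad one their disjointness alone is used, but the selection is made
among the enlarged balls, because these must be disjoint to enter a John--Nirenberg sum.
\<close>

lemma stopping_packing_step:
  assumes R: "0 < R" and F: "F \<in> sets M" and F': "F' \<in> sets M" "F' \<subseteq> F" and \<sigma>: "0 \<le> \<sigma>"
    and a: "packing_bound M R (stopping M R A F) a"
    and good: "\<And>s. s \<in> stopping M R A F \<Longrightarrow> s \<notin> Bad \<Longrightarrow>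
       measure M (F' \<inter> dyadic_ball (4 * R) s) \<le> \<sigma> * measure M (dyadic_ball (4 * R) s)"
    and b: "packing_bound M (4 * R) (stopping M R A F \<inter> Bad) b"
  shows "packing_bound M R (stopping M R A F') (2 * \<sigma> * (c\<^sup>2 * a) + c\<^sup>2 * b)"
  unfolding packing_bound_def
proof (intro allI impI)
  fix S assume S: "finite S" "S \<subseteq> stopping M R A F'" "disjoint_family_on (dyadic_ball R) S"
  have heavy': "heavy M R F' s" if "s \<in> S" for s
    using that S(2) by (auto simp: stopping_def)
  have mono: "measure M (F' \<inter> dyadic_ball R s) \<le> measure M (F \<inter> dyadic_ball R s)" for s
    using F F' by (intro measure_mono_fmeasurable fmeasurableI2[OF dyadic_ball_fmeasurable[of R s]]) auto
  have "\<exists>t. t \<in> stopping M R A F \<and> dyadic_ball R s \<subseteq> dyadic_ball R t" if s: "s \<in> S" for s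
  proof -
    obtain x l where xl: "s = (x, l)" by force
    have "x \<in> A" using s S(2) xl by (auto simp: stopping_def)
    moreover have "heavy M R F (x, l)"
      using heavy'[OF s] mono[of s] xl by (simp add: heavy_def)
    ultimately obtain k where "k \<le> l" "(x, k) \<in> stopping M R A F"
      by (rule stopping_below_heavy)
    moreover have "dyadic_ball R s \<subseteq> dyadic_ball R (x, k)"
      unfolding xl by (rule dyadic_ball_antimono[OF R \<open>k \<le> l\<close>])
    ultimately show ?thesis by blast
  qed
  then obtain \<tau> where \<tau>: "\<And>s. s \<in> S \<Longrightarrow> \<tau> s \<in> stopping M R A F"
      "\<And>s. s \<in> S \<Longrightarrow> dyadic_ball R s \<subseteq> dyadic_ball R (\<tau> s)"
    by metis
  define G where "G = {s \<in> S. \<tau> s \<notin> Bad}"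
  define H where "H = {s \<in> S. \<tau> s \<in> Bad}"
  have "(\<Sum>s\<in>G. measure M (dyadic_ball R s)) \<le> 2 * \<sigma> * (c\<^sup>2 * a)"
  proof (rule sum_le_engulfing[where \<tau>=\<tau> and T="stopping M R A F - Bad"])
    show "packing_bound M R (stopping M R A F - Bad) a"
      using a by (rule packing_bound_mono) auto
    fix v V assume v: "v \<in> stopping M R A F - Bad" and V: "V \<subseteq> G"
      "\<And>s. s \<in> V \<Longrightarrow> dyadic_ball R s \<subseteq> dyadic_ball (4 * R) v"
    have "finite V" using V(1) S(1) by (auto simp: G_def intro: finite_subset)
    have "(\<Sum>s\<in>V. measure M (dyadic_ball R s)) \<le> (\<Sum>s\<in>V. 2 * measure M (F' \<inter> dyadic_ball R s))"
      using heavy' V(1) by (intro sum_mono) (auto simp: G_def heavy_def)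
    also have "\<dots> = 2 * (\<Sum>s\<in>V. measure M (F' \<inter> dyadic_ball R s))" by (simp add: sum_distrib_left)
    also have "(\<Sum>s\<in>V. measure M (F' \<inter> dyadic_ball R s)) \<le> measure M (F' \<inter> dyadic_ball (4 * R) v)"
    proof (rule sum_measure_disjoint_le[OF \<open>finite V\<close>])
      show "disjoint_family_on (\<lambda>s. F' \<inter> dyadic_ball R s) V"
        using S(3) V(1) unfolding disjoint_family_on_def G_def by blast
      show "F' \<inter> dyadic_ball (4 * R) v \<in> fmeasurable M"
        using F' by (intro fmeasurableI2[OF dyadic_ball_fmeasurable[of "4*R" v]]) auto
    qed (use F' V(2) in auto)
    also have "\<dots> \<le> \<sigma> * measure M (dyadic_ball (4 * R) v)"
      using good v by blast
    finally show "(\<Sum>s\<in>V. measure M (dyadic_ball R s)) \<le> 2 * \<sigma> * measure M (dyadic_ball (4 * R) v)"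
      by simp
  qed (use R \<sigma> S(1) \<tau> in \<open>simp_all add: G_def\<close>)
  moreover have "(\<Sum>s\<in>H. measure M (dyadic_ball R s)) \<le> 1 * (c\<^sup>2 * b)"
  proof (rule sum_le_engulfing[where \<tau>=\<tau> and T="stopping M R A F \<inter> Bad" and R="4 * R", OF _ _ _ _ _ b])
    fix s assume "s \<in> H"
    then show "dyadic_ball R s \<subseteq> dyadic_ball (4 * R) (\<tau> s)"
      using R by (intro order_trans[OF \<tau>(2) dyadic_ball_mono]) (simp_all add: H_def)
  next
    fix v V assume V: "V \<subseteq> H" "\<And>s. s \<in> V \<Longrightarrow> dyadic_ball R s \<subseteq> dyadic_ball (4 * (4 * R)) v"
    have "finite V" using V(1) S(1) by (auto simp: H_def intro: finite_subset)
    moreover have "disjoint_family_on (dyadic_ball R) V"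
      using S(3) by (rule disjoint_family_on_mono[rotated]) (use V(1) in \<open>auto simp: H_def\<close>)
    ultimately have "(\<Sum>s\<in>V. measure M (dyadic_ball R s)) \<le> measure M (dyadic_ball (4 * (4 * R)) v)"
      using V(2) by (intro sum_measure_disjoint_le) auto
    then show "(\<Sum>s\<in>V. measure M (dyadic_ball R s)) \<le> 1 * measure M (dyadic_ball (4 * (4 * R)) v)"
      by simp
  qed (use R S(1) \<tau> in \<open>simp_all add: H_def\<close>)
  moreover have "(\<Sum>s\<in>S. measure M (dyadic_ball R s)) =
      (\<Sum>s\<in>G. measure M (dyadic_ball R s)) + (\<Sum>s\<in>H. measure M (dyadic_ball R s))"
    unfolding G_def H_def using S(1)
    by (subst sum.union_disjoint[symmetric]) (auto intro!: sum.cong)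
  ultimately show "(\<Sum>s\<in>S. measure M (dyadic_ball R s)) \<le> 2 * \<sigma> * (c\<^sup>2 * a) + c\<^sup>2 * b" by simp
qed

lemma stopping_packing_initial:
  assumes F: "F \<in> fmeasurable M"
  shows "packing_bound M R (stopping M R A F) (2 * measure M F)"
  unfolding packing_bound_def
proof (intro allI impI)
  fix S assume S: "finite S" "S \<subseteq> stopping M R A F" "disjoint_family_on (dyadic_ball R) S"
  have "(\<Sum>s\<in>S. measure M (dyadic_ball R s)) \<le> (\<Sum>s\<in>S. 2 * measure M (F \<inter> dyadic_ball R s))"
    using S(2) by (intro sum_mono) (auto simp: stopping_def heavy_def)
  also have "\<dots> = 2 * (\<Sum>s\<in>S. measure M (F \<inter> dyadic_ball R s))" by (simp add: sum_distrib_left)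
  also have "(\<Sum>s\<in>S. measure M (F \<inter> dyadic_ball R s)) \<le> measure M F"
  proof (rule sum_measure_disjoint_le[OF S(1) _ F])
    show "disjoint_family_on (\<lambda>s. F \<inter> dyadic_ball R s) S"
      using S(3) unfolding disjoint_family_on_def by blast
  qed (use F in auto)
  finally show "(\<Sum>s\<in>S. measure M (dyadic_ball R s)) \<le> 2 * measure M F" by simp
qed

section \<open>Medians and the John--Nirenberg functional\<close>

lemma superlevel_set_measurable:
  assumes f: "f \<in> borel_measurable (restrict_space M \<Omega>)" and "\<Omega> \<in> sets M" "B \<in> sets M" "B \<subseteq> \<Omega>"
  shows "{x \<in> B. f x > ereal \<tau>} \<in> sets M"
proof -
  have "{x \<in> space (restrict_space M \<Omega>). ereal \<tau> < f x} \<in> sets (restrict_space M \<Omega>)"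
    using f by measurable
  then have "{x \<in> \<Omega>. ereal \<tau> < f x} \<in> sets M"
    using assms(2) by (simp add: space_restrict_space sets_restrict_space_iff)
  then have "B \<inter> {x \<in> \<Omega>. ereal \<tau> < f x} \<in> sets M"
    using assms(3) by auto
  moreover have "B \<inter> {x \<in> \<Omega>. ereal \<tau> < f x} = {x \<in> B. f x > ereal \<tau>}"
    using assms(4) by auto
  ultimately show ?thesis by simp
qed

lemma deviation_set_measurable:
  assumes f: "f \<in> borel_measurable (restrict_space M \<Omega>)" and "\<Omega> \<in> sets M" "B \<in> sets M" "B \<subseteq> \<Omega>"
  shows "{x \<in> B. \<bar>f x - ereal q\<bar> > ereal \<tau>} \<in> sets M"
proof -
  have "(\<lambda>x. \<bar>f x - ereal q\<bar>) \<in> borel_measurable (restrict_space M \<Omega>)"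
    using f by measurable
  then show ?thesis using assms(2-4) by (rule superlevel_set_measurable)
qed

text \<open>
Chebyshev's inequality for the John--Nirenberg functional: if no constant is \<open>\<tau>\<close>-close to \<open>f\<close> on a ball
outside a portion \<open>s\<close>, then all medians of \<open>\<bar>f - q\<bar>\<close> over the ball are at least \<open>\<tau>\<close>.
\<close>

lemma JN_sup_packing:
  assumes R: "0 < R" and \<Omega>: "\<Omega> \<in> sets M" and f: "f \<in> borel_measurable (restrict_space M \<Omega>)"
    and fin: "JN_sup M p s \<Omega> f < \<infinity>" and \<tau>: "0 < \<tau>" and s: "0 < s" and p: "0 < p"
  shows "packing_bound M R {t. dyadic_ball R t \<subseteq> \<Omega> \<and>
      (\<forall>q. \<not> measure M {x \<in> dyadic_ball R t. \<bar>f x - ereal q\<bar> > ereal \<tau>} < s * measure M (dyadic_ball R t))}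
      (enn2real (JN_sup M p s \<Omega> f) / \<tau> powr p)"
  unfolding packing_bound_def
proof (intro allI impI)
  fix S assume S: "finite S" "S \<subseteq> {t. dyadic_ball R t \<subseteq> \<Omega> \<and>
      (\<forall>q. \<not> measure M {x \<in> dyadic_ball R t. \<bar>f x - ereal q\<bar> > ereal \<tau>} < s * measure M (dyadic_ball R t))}"
      "disjoint_family_on (dyadic_ball R) S"
  define \<phi> where "\<phi> B = emeasure M B *
        ennreal_powr (e2ennreal (INF c::real. max_median M s (\<lambda>x. \<bar>f x - ereal c\<bar>) B)) p" for B
  \<comment> \<open>The functional sums over a set of balls, so distinct indices must give distinct balls.\<close>
  have inj: "inj_on (dyadic_ball R) S"
    using S(3) dyadic_ball_nonempty[OF R] unfolding disjoint_family_on_def inj_on_def by (metis Int_absorb)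
  have fam: "dyadic_ball R ` S \<in> disjoint_balls \<Omega>"
    unfolding disjoint_balls_def
  proof (intro CollectI conjI ballI)
    show "countable (dyadic_ball R ` S)" using S(1) by (simp add: countable_finite)
    show "disjoint (dyadic_ball R ` S)"
      using S(3) by (rule disjoint_family_on_disjoint_image)
    fix B assume "B \<in> dyadic_ball R ` S"
    then obtain t where t: "t \<in> S" "B = dyadic_ball R t" by auto
    then show "B \<subseteq> \<Omega>" using S(2) by auto
    show "\<exists>x r. 0 < r \<and> B = ball x r"
      using R t by (intro exI[of _ "fst t"] exI[of _ "R / 2 ^ snd t"]) (simp add: dyadic_ball_def)
  qed
  have summand: "ennreal (measure M (dyadic_ball R t) * \<tau> powr p) \<le> \<phi> (dyadic_ball R t)" if t: "t \<in> S" for t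
  proof -
    let ?B = "dyadic_ball R t"
    have B\<Omega>: "?B \<subseteq> \<Omega>" using t S(2) by auto
    have meas: "{x \<in> ?B. \<bar>f x - ereal q\<bar> > ereal a} \<in> sets M" for q a
      by (rule deviation_set_measurable[OF f \<Omega> _ B\<Omega>]) simp
    have fm: "{x \<in> ?B. \<bar>f x - ereal q\<bar> > ereal a} \<in> fmeasurable M" for q a
      by (rule fmeasurableI2[OF dyadic_ball_fmeasurable[of R t] _ meas]) auto
    have "ereal \<tau> \<le> max_median M s (\<lambda>x. \<bar>f x - ereal q\<bar>) ?B" for q
      unfolding max_median_def
    proof (rule Inf_greatest, safe)
      fix a :: real
      assume a: "emeasure M {x \<in> ?B. ereal a < \<bar>f x - ereal q\<bar>} < ennreal s * emeasure M ?B"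
      then have lt: "measure M {x \<in> ?B. ereal a < \<bar>f x - ereal q\<bar>} < s * measure M ?B"
        using s by (simp add: emeasure_eq_measure2 fm ennreal_mult[symmetric] ennreal_less_iff)
      show "ereal \<tau> \<le> ereal a"
      proof (rule ccontr)
        assume "\<not> ereal \<tau> \<le> ereal a"
        then have "ereal a \<le> ereal \<tau>" by auto
        then have "measure M {x \<in> ?B. ereal \<tau> < \<bar>f x - ereal q\<bar>} \<le> measure M {x \<in> ?B. ereal a < \<bar>f x - ereal q\<bar>}"
          by (intro measure_mono_fmeasurable meas fm Collect_mono conj_mono imp_refl impI)
            (erule (1) le_less_trans)
        moreover have "\<not> measure M {x \<in> ?B. ereal \<tau> < \<bar>f x - ereal q\<bar>} < s * measure M ?B"
          using t S(2) by blast
        ultimately show False using lt by linarith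
      qed
    qed
    then have "ereal \<tau> \<le> (INF q::real. max_median M s (\<lambda>x. \<bar>f x - ereal q\<bar>) ?B)"
      by (intro INF_greatest) auto
    then have ge: "ennreal \<tau> \<le> e2ennreal (INF q::real. max_median M s (\<lambda>x. \<bar>f x - ereal q\<bar>) ?B)"
      using e2ennreal_mono by fastforce
    have "ennreal (\<tau> powr p) \<le> ennreal_powr (e2ennreal (INF q::real. max_median M s (\<lambda>x. \<bar>f x - ereal q\<bar>) ?B)) p"
    proof (cases "e2ennreal (INF q::real. max_median M s (\<lambda>x. \<bar>f x - ereal q\<bar>) ?B)" rule: ennreal_cases)
      case (real u)
      then have "\<tau> \<le> u" using ge \<tau> by simp
      then show ?thesis using real \<tau> p by (simp add: ennreal_powr_def powr_mono2)
    qed (simp add: ennreal_powr_def)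
    then show ?thesis unfolding \<phi>_def
      by (simp add: ennreal_mult emeasure_eq_measure2 mult_left_mono)
  qed
  have "ennreal (\<Sum>t\<in>S. measure M (dyadic_ball R t) * \<tau> powr p) = (\<Sum>t\<in>S. ennreal (measure M (dyadic_ball R t) * \<tau> powr p))"
    by (subst sum_ennreal) auto
  also have "\<dots> \<le> (\<Sum>t\<in>S. \<phi> (dyadic_ball R t))" using summand by (intro sum_mono)
  also have "\<dots> = (\<Sum>\<^sub>\<infinity>B\<in>dyadic_ball R ` S. \<phi> B)"
    using S(1) inj by (simp add: sum.reindex)
  also have "\<dots> \<le> JN_sup M p s \<Omega> f"
    unfolding JN_sup_def \<phi>_def[symmetric] using fam by (intro SUP_upper)
  also have "\<dots> = ennreal (enn2real (JN_sup M p s \<Omega> f))"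
    using fin by (simp add: less_top)
  finally have "(\<Sum>t\<in>S. measure M (dyadic_ball R t) * \<tau> powr p) \<le> enn2real (JN_sup M p s \<Omega> f)"
    by (simp add: ennreal_le_iff)
  then show "(\<Sum>t\<in>S. measure M (dyadic_ball R t)) \<le> enn2real (JN_sup M p s \<Omega> f) / \<tau> powr p"
    using \<tau> by (simp add: sum_distrib_right[symmetric] pos_le_divide_eq)
qed

text \<open>
A constant that is close to \<open>f\<close> on more than the portion \<open>1 - s\<close> is close to the maximal \<open>r\<close>-median: \<open>s \<le> r\<close> gives the
bound from above, and \<open>r \<le> 1/2\<close> that from below.  In particular the median is finite, although \<open>f\<close> may take infinite values.
\<close>

lemma max_median_near:
  assumes f: "f \<in> borel_measurable (restrict_space M \<Omega>)" and \<Omega>: "\<Omega> \<in> sets M" and B: "B \<subseteq> \<Omega>" "B \<in> fmeasurable M"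
    and dev: "measure M {x \<in> B. \<bar>f x - ereal q\<bar> > ereal \<tau>} < s * measure M B" and s: "s \<le> r" "r \<le> 1 / 2"
  obtains m where "max_median M r f B = ereal m" "\<bar>m - q\<bar> \<le> \<tau>"
proof -
  let ?D = "{x \<in> B. \<bar>f x - ereal q\<bar> > ereal \<tau>}"
  have sB: "B \<in> sets M" using B by auto
  have D: "?D \<in> sets M" by (rule deviation_set_measurable[OF f \<Omega> sB B(1)])
  have L: "{x \<in> B. f x > ereal a} \<in> sets M" for a
    by (rule superlevel_set_measurable[OF f \<Omega> sB B(1)])
  have Lfm: "{x \<in> B. f x > ereal a} \<in> fmeasurable M" for a
    by (rule fmeasurableI2[OF B(2) _ L]) auto
  have Dfm: "?D \<in> fmeasurable M" by (rule fmeasurableI2[OF B(2) _ D]) auto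
  have pos: "0 < s * measure M B" using dev measure_nonneg[of M ?D] by linarith
  then have r: "0 < r" "0 < measure M B"
    using s(1) measure_nonneg[of M B] by (auto simp: zero_less_mult_iff)
  have iff: "emeasure M {x \<in> B. f x > ereal a} < ennreal r * emeasure M B \<longleftrightarrow>
      measure M {x \<in> B. f x > ereal a} < r * measure M B" for a
    using r by (simp add: emeasure_eq_measure2 Lfm B ennreal_mult[symmetric] ennreal_less_iff)
  have sr: "s * measure M B \<le> r * measure M B" using s(1) r by (intro mult_right_mono) auto
  have upper: "max_median M r f B \<le> ereal (q + \<tau>)"
    unfolding max_median_def
  proof (rule Inf_lower, intro CollectI exI conjI)
    have "{x \<in> B. f x > ereal (q + \<tau>)} \<subseteq> ?D"
    proof safe
      fix x assume "ereal (q + \<tau>) < f x"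
      then show "ereal \<tau> < \<bar>f x - ereal q\<bar>" by (cases "f x") auto
    qed
    then have "measure M {x \<in> B. f x > ereal (q + \<tau>)} \<le> measure M ?D"
      by (intro measure_mono_fmeasurable L Dfm)
    then show "emeasure M {x \<in> B. f x > ereal (q + \<tau>)} < ennreal r * emeasure M B"
      unfolding iff using dev sr by linarith
  qed simp
  have lower: "ereal (q - \<tau>) \<le> max_median M r f B"
    unfolding max_median_def
  proof (rule Inf_greatest, safe)
    fix a assume "emeasure M {x \<in> B. ereal a < f x} < ennreal r * emeasure M B"
    then have a: "measure M {x \<in> B. ereal a < f x} < r * measure M B" by (simp add: iff)
    show "ereal (q - \<tau>) \<le> ereal a"
    proof (rule ccontr)
      assume "\<not> ?thesis"
      then have lt: "a < q - \<tau>" by simp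
      have "B - ?D \<subseteq> {x \<in> B. ereal a < f x}"
      proof safe
        fix x assume "\<not> ereal \<tau> < \<bar>f x - ereal q\<bar>"
        then show "ereal a < f x" using lt by (cases "f x") auto
      qed
      then have "measure M (B - ?D) \<le> measure M {x \<in> B. ereal a < f x}"
        using sB D by (intro measure_mono_fmeasurable Lfm) auto
      moreover have "measure M (B - ?D) = measure M B - measure M ?D"
        using B D sB fmeasurableD2[OF B(2)] by (intro measure_Diff) auto
      moreover have "r * measure M B \<le> 1 / 2 * measure M B"
        using s(2) by (intro mult_right_mono) auto
      ultimately show False using a dev sr by linarith
    qed
  qed
  obtain m where m: "max_median M r f B = ereal m"
    using upper lower by (cases "max_median M r f B") auto
  then show thesis using upper lower by (intro that[OF m]) auto
qed

section \<open>The weak type estimate\<close>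

text \<open>
The weak type estimate with a strict upper bound \<open>N\<close> for the functional in place of its value.  The strictness
makes the scale \<open>L\<close> in the proof positive, also when the functional vanishes, and excludes that a single ball uses up all of \<open>N\<close>.
\<close>

lemma JN_weak_type:
  fixes f :: "'a \<Rightarrow> ereal"
  assumes p: "1 < p" and s: "0 < s" and h: "0 < h" "h \<le> 1" and \<rho>: "0 < \<rho>"
    and f: "f \<in> borel_measurable (restrict_space M \<Omega>)" and \<Omega>: "\<Omega> \<in> sets M"
    and sub: "ball x\<^sub>0 ((1 + h) * \<rho>) \<subseteq> \<Omega>"
    and fin: "JN_sup M p s \<Omega> f < \<infinity>" and N: "enn2real (JN_sup M p s \<Omega> f) < N"
    and j: "4 + 2 * h \<le> 2 ^ j * h" "s * c ^ j \<le> 1 / 2" and s3: "s * c ^ 3 \<le> 1 / 8"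
    and r: "s \<le> r" "r \<le> 1 / 2" and t: "0 < t"
  obtains m where "max_median M r f (ball x\<^sub>0 \<rho>) = ereal m"
    "measure M {x \<in> ball x\<^sub>0 \<rho>. \<bar>f x - ereal m\<bar> > ereal t} \<le>
       2 powr (p + 3) * c ^ 4 / (2 powr (1 / p) - 1) powr p * (N / t powr p)"
proof -
  define X where "X = ball x\<^sub>0 ((1 + h) * \<rho>)"
  define B where "B = ball x\<^sub>0 \<rho>"
  define R where "R = h * \<rho>"
  have R: "0 < R" using h \<rho> by (simp add: R_def)
  have XB: "X \<in> fmeasurable M" "X \<in> sets M" "B \<in> fmeasurable M" "B \<in> sets M" by (simp_all add: X_def B_def)
  have BX: "B \<subseteq> X" unfolding B_def X_def using h \<rho> by (intro subset_ball) (simp add: algebra_simps)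
  have X\<Omega>: "X \<subseteq> \<Omega>" using sub by (simp add: X_def)
  have dev_meas: "{x \<in> A. \<bar>f x - ereal q\<bar> > ereal a} \<in> sets M" if "A \<in> sets M" "A \<subseteq> X" for A q a
    by (rule deviation_set_measurable[OF f \<Omega> that(1) order_trans[OF that(2) X\<Omega>]])
  have dev_fm: "{x \<in> A. \<bar>f x - ereal q\<bar> > ereal a} \<in> fmeasurable M" if "A \<in> sets M" "A \<subseteq> X" for A q a
    using dev_meas[OF that, of a q] that(2) by (intro fmeasurableI2[OF XB(1)]) auto
  have ck: "s * c ^ k \<le> 1 / 8" if "k \<le> 3" for k
  proof -
    have "c ^ k \<le> c ^ 3" using c_gt_1 that by (intro power_increasing) auto
    then show ?thesis using s3 s by (meson mult_left_mono order_trans less_imp_le)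
  qed
  have s8: "s \<le> 1 / 8" using ck[of 0] by simp
  have Bpos: "0 < measure M B" using \<rho> by (simp add: B_def measure_ball_pos)
  have BleX: "measure M B \<le> measure M X" using BX XB by (intro measure_mono_fmeasurable)
  have XleB: "measure M X \<le> c * measure M B"
  proof -
    have "measure M X \<le> measure M (ball x\<^sub>0 (2 * \<rho>))"
      unfolding X_def using h \<rho> by (intro measure_mono_fmeasurable subset_ball) auto
    then show ?thesis using measure_ball_double[OF \<rho>, of x\<^sub>0] by (simp add: B_def)
  qed
  have sX: "s * measure M X \<le> 1 / 8 * measure M B"
  proof -
    have "s * measure M X \<le> s * (c * measure M B)" using XleB s by (intro mult_left_mono) auto
    also have "\<dots> = s * c ^ 1 * measure M B" by simp
    also have "\<dots> \<le> 1 / 8 * measure M B" using ck[of 1] by (intro mult_right_mono) auto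
    finally show ?thesis .
  qed
  have N0: "0 < N" using N enn2real_nonneg[of "JN_sup M p s \<Omega> f"] by linarith
  define L where "L = (N / measure M B) powr (1 / p)"
  have L: "0 < L" using N0 Bpos by (simp add: L_def)
  have Lp: "L powr p = N / measure M B" using p N0 Bpos by (simp add: L_def powr_powr)
  have packing_N: "packing_bound M R' {t. dyadic_ball R' t \<subseteq> \<Omega> \<and>
      (\<forall>q. \<not> measure M {x \<in> dyadic_ball R' t. \<bar>f x - ereal q\<bar> > ereal \<tau>} < s * measure M (dyadic_ball R' t))}
      (N / \<tau> powr p)" if "0 < R'" "0 < \<tau>" for R' \<tau>
    by (rule packing_bound_mono[OF JN_sup_packing[OF that(1) \<Omega> f fin that(2) s]])
      (use p N in \<open>auto intro!: divide_right_mono\<close>)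
  \<comment> \<open>An oscillation of \<open>L\<close> on such a ball would alone contribute \<open>\<mu>(B) L\<^sup>p = N\<close>, which exceeds the functional.\<close>
  have center: "\<exists>q. measure M {x \<in> ball y u. \<bar>f x - ereal q\<bar> > ereal L} < s * measure M (ball y u)"
    if u: "0 < u" "ball y u \<subseteq> \<Omega>" "measure M B \<le> measure M (ball y u)" for y u
  proof (rule ccontr)
    assume neg: "\<not> ?thesis"
    have "(\<Sum>t\<in>{(y, 0)}. measure M (dyadic_ball u t)) \<le> enn2real (JN_sup M p s \<Omega> f) / L powr p"
      by (rule packing_boundD[OF JN_sup_packing[OF u(1) \<Omega> f fin L s]])
        (use p u(2) neg in \<open>auto simp: disjoint_family_on_def dyadic_ball_def\<close>)
    also have "\<dots> < N / L powr p" using N L by (intro divide_strict_right_mono) auto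
    also have "\<dots> = measure M B" using Lp N0 Bpos by simp
    finally show False using u(3) by (simp add: dyadic_ball_def)
  qed
  \<comment> \<open>The constant \<open>q\<^sub>X\<close> serves the large ball, but only \<open>q\<^sub>B\<close> can be compared with the median directly, as \<open>r = s\<close> is possible;
    hence the detour through both and the level \<open>4 L\<close>.\<close>
  obtain q\<^sub>B where qB: "measure M {x \<in> B. \<bar>f x - ereal q\<^sub>B\<bar> > ereal L} < s * measure M B"
    using center[OF \<rho>, of x\<^sub>0] BX X\<Omega> by (auto simp: B_def)
  obtain q\<^sub>X where qX: "measure M {x \<in> X. \<bar>f x - ereal q\<^sub>X\<bar> > ereal L} < s * measure M X"
    using center[of "(1 + h) * \<rho>" x\<^sub>0] X\<Omega> BleX h \<rho> by (auto simp: X_def)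
  obtain m where m: "max_median M r f B = ereal m" "\<bar>m - q\<^sub>B\<bar> \<le> L"
    using max_median_near[OF f \<Omega> _ XB(3) qB r] BX X\<Omega> by blast
  have "\<bar>q\<^sub>B - q\<^sub>X\<bar> \<le> L + L"
  proof (rule common_center[OF XB(3)])
    have "measure M {x \<in> B. \<bar>f x - ereal q\<^sub>X\<bar> > ereal L} \<le> measure M {x \<in> X. \<bar>f x - ereal q\<^sub>X\<bar> > ereal L}"
      using BX XB by (intro measure_mono_fmeasurable dev_meas dev_fm) auto
    moreover have "s * measure M B \<le> 1 / 8 * measure M B" using s8 by (intro mult_right_mono) auto
    ultimately show "measure M {x \<in> B. \<bar>f x - ereal q\<^sub>B\<bar> > ereal L} +
        measure M {x \<in> B. \<bar>f x - ereal q\<^sub>X\<bar> > ereal L} < measure M B"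
      using qB qX sX Bpos by linarith
  qed (use XB BX dev_meas in auto)
  then have mX: "\<bar>m - q\<^sub>X\<bar> + L \<le> 4 * L" using m(2) by linarith
  define F where "F l = {x \<in> X. \<bar>f x - ereal m\<bar> > ereal l}" for l
  have F_sets: "F l \<in> sets M" and F_fm: "F l \<in> fmeasurable M" for l
    using dev_meas[of X l m] dev_fm[of X l m] XB by (auto simp: F_def)
  have F_small: "measure M (F l) < s * measure M X" if "4 * L \<le> l" for l
  proof -
    have "measure M (F l) \<le> measure M {x \<in> X. \<bar>f x - ereal q\<^sub>X\<bar> > ereal L}"
      unfolding F_def using mX that XB
      by (intro measure_mono_fmeasurable deviation_recenter dev_meas dev_fm) auto
    then show ?thesis using qX by linarith
  qed
  have light: "\<not> heavy M R (F l) (x, k)" if l: "4 * L \<le> l" and x: "x \<in> B" and k: "k < 2" for l x k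
  proof -
    \<comment> \<open>All of \<open>X\<close> is reached from the ball of half the initial radius by \<open>j\<close> doublings.\<close>
    have "X \<subseteq> ball x (2 ^ j * (R / 2))"
    proof
      fix y assume "y \<in> X"
      then have "dist x y < (2 + h) * \<rho>"
        using x dist_triangle[of x y x\<^sub>0] by (simp add: X_def B_def dist_commute algebra_simps)
      also have "\<dots> \<le> (2 ^ j * h / 2) * \<rho>" using j(1) \<rho> by (intro mult_right_mono) auto
      finally show "y \<in> ball x (2 ^ j * (R / 2))" by (simp add: R_def)
    qed
    then have "measure M X \<le> measure M (ball x (2 ^ j * (R / 2)))"
      using XB by (intro measure_mono_fmeasurable) auto
    also have "\<dots> \<le> c ^ j * measure M (ball x (R / 2))" using R by (intro measure_ball_pow2) auto
    finally have "s * measure M X \<le> s * (c ^ j * measure M (ball x (R / 2)))"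
      using s by (intro mult_left_mono) auto
    also have "\<dots> = (s * c ^ j) * measure M (ball x (R / 2))" by simp
    also have "\<dots> \<le> 1 / 2 * measure M (ball x (R / 2))" using j(2) by (intro mult_right_mono) auto
    also have "\<dots> \<le> 1 / 2 * measure M (dyadic_ball R (x, k))"
    proof -
      have "k = 0 \<or> k = 1" using k by auto
      then have "ball x (R / 2) \<subseteq> dyadic_ball R (x, k)"
        using R by (auto simp: dyadic_ball_def intro!: subset_ball)
      then show ?thesis by (intro mult_left_mono measure_mono_fmeasurable) auto
    qed
    finally have "measure M (F l) < 1 / 2 * measure M (dyadic_ball R (x, k))"
      using F_small[OF l] by linarith
    moreover have "measure M (F l \<inter> dyadic_ball R (x, k)) \<le> measure M (F l)"
      using F_sets F_fm by (intro measure_mono_fmeasurable sets.Int) auto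
    ultimately show ?thesis by (simp add: heavy_def)
  qed
  define K where "K = 2 powr (1 / p)"
  have K: "1 < K" using p by (simp add: K_def)
  have Kp: "K powr p = 2" using p by (simp add: K_def powr_powr)
  \<comment> \<open>Chosen so that \<open>l + 2 d l = K l\<close>: one \<open>d l\<close> for moving the centre to \<open>m\<close>, one for the deviation itself.\<close>
  define d where "d = (K - 1) / 2"
  have d: "0 < d" using K by (simp add: d_def)
  have step: "packing_bound M R (stopping M R B (F (K * l))) (a / 4 + c\<^sup>2 * (N / (d * l) powr p))"
    if l: "4 * L \<le> l" and a: "packing_bound M R (stopping M R B (F l)) a" for l a
  proof -
    have lpos: "0 < l" using l L by linarith
    define Bad where "Bad = {t. dyadic_ball (4 * R) t \<subseteq> \<Omega> \<and>
      (\<forall>q. \<not> measure M {x \<in> dyadic_ball (4 * R) t. \<bar>f x - ereal q\<bar> > ereal (d * l)} < s * measure M (dyadic_ball (4 * R) t))}"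
    have step': "packing_bound M R (stopping M R B (F (K * l))) (2 * s * (c\<^sup>2 * a) + c\<^sup>2 * (N / (d * l) powr p))"
    proof (rule stopping_packing_step[OF R F_sets F_sets _ _ a])
      show "F (K * l) \<subseteq> F l"
      proof -
        have "l \<le> K * l" using K lpos by simp
        then show ?thesis unfolding F_def by (intro deviation_recenter) simp
      qed
      show "packing_bound M (4 * R) (stopping M R B (F l) \<inter> Bad) (N / (d * l) powr p)"
      proof (rule packing_bound_mono[OF _ Int_lower2 order_refl])
        show "packing_bound M (4 * R) Bad (N / (d * l) powr p)"
          unfolding Bad_def by (rule packing_N) (use R d lpos in simp_all)
      qed
      fix t assume t: "t \<in> stopping M R B (F l)" "t \<notin> Bad"
      obtain x k where xk: "t = (x, k)" by force
      have x: "x \<in> B" and hv: "heavy M R (F l) (x, k)" and nh: "\<And>i. i < k \<Longrightarrow> \<not> heavy M R (F l) (x, i)"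
        using t(1) xk by (auto simp: stopping_def)
      \<comment> \<open>Since the two largest balls are light, the four-fold enlargement of a stopping ball was examined and found light.\<close>
      have "2 \<le> k" using light[OF l x] hv by (meson not_le)
      then obtain i where i: "k = i + 2" by (metis le_add_diff_inverse2)
      let ?A = "dyadic_ball R (x, i)"
      have A4: "dyadic_ball (4 * R) t = ?A" unfolding xk i by (rule dyadic_ball_coarser)
      have AX: "?A \<subseteq> X"
      proof
        fix y assume "y \<in> ?A"
        then have "dist x y < R" using R dyadic_ball_antimono[OF R, of 0 i x]
          by (auto simp: dyadic_ball_def)
        then show "y \<in> X" using x dist_triangle[of x\<^sub>0 y x] by (simp add: X_def B_def R_def algebra_simps)
      qed
      obtain q where q: "measure M {x \<in> ?A. \<bar>f x - ereal q\<bar> > ereal (d * l)} < s * measure M ?A"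
        using t(2) order_trans[OF AX X\<Omega>] unfolding Bad_def A4 mem_Collect_eq by blast
      have FA: "F u \<inter> ?A = {x \<in> ?A. \<bar>f x - ereal m\<bar> > ereal u}" for u
        using AX by (auto simp: F_def)
      have light_A: "2 * measure M {x \<in> ?A. \<bar>f x - ereal m\<bar> > ereal l} < measure M ?A"
        using nh[of i] i by (simp add: heavy_def FA)
      have "\<bar>m - q\<bar> \<le> l + d * l"
      proof (rule common_center[OF dyadic_ball_fmeasurable])
        have "s * measure M ?A \<le> 1 / 8 * measure M ?A" using s8 by (intro mult_right_mono) auto
        then show "measure M {x \<in> ?A. \<bar>f x - ereal m\<bar> > ereal l} +
          measure M {x \<in> ?A. \<bar>f x - ereal q\<bar> > ereal (d * l)} < measure M ?A"
          using q light_A measure_nonneg[of M ?A] by linarith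
      qed (use AX dev_meas in auto)
      moreover have "l + d * l + d * l = K * l" by (simp add: d_def field_simps)
      ultimately have "measure M (F (K * l) \<inter> ?A) \<le> measure M {x \<in> ?A. \<bar>f x - ereal q\<bar> > ereal (d * l)}"
        unfolding FA using AX by (intro measure_mono_fmeasurable deviation_recenter dev_meas dev_fm) auto
      then show "measure M (F (K * l) \<inter> dyadic_ball (4 * R) t) \<le> s * measure M (dyadic_ball (4 * R) t)"
        unfolding A4 using q by linarith
    qed (use s in auto)
    have "2 * s * (c\<^sup>2 * a) \<le> a / 4"
      using mult_right_mono[OF ck[of 2] packing_bound_nonneg[OF a]] by simp
    then show ?thesis by (rule packing_bound_mono[OF step' order_refl add_right_mono])
  qed
  \<comment> \<open>The initial mass is bounded through \<open>C\<close>, and the oscillating balls of all levels through \<open>\<Phi>\<close>.\<close>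
  define C where "C = 2 powr p * 2 powr p * N / 2"
  define \<Phi> where "\<Phi> = 4 * c\<^sup>2 * (N / d powr p)"
  have C\<Phi>: "0 \<le> C" "0 \<le> \<Phi>" using N0 by (simp_all add: C_def \<Phi>_def)
  have "packing_bound M R (stopping M R B (F l)) ((C + \<Phi>) / l powr p)"
    if "4 * L \<le> l" "l \<le> 4 * L * K ^ Suc n" for l n
    using that
  proof (induction n arbitrary: l)
    case 0
    have l0: "0 < l" using 0 L by linarith
    have "l powr p \<le> (4 * L * K) powr p" using 0 l0 p by (intro powr_mono2) auto
    also have "\<dots> = 4 powr p * L powr p * 2" using L K Kp by (simp add: powr_mult)
    also have "4 powr p = 2 powr p * (2 powr p :: real)" by (simp flip: powr_mult)
    finally have "measure M B / 4 * l powr p \<le> measure M B / 4 * (2 powr p * 2 powr p * L powr p * 2)"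
      by (intro mult_left_mono) auto
    also have "\<dots> = C" using Lp Bpos by (simp add: C_def)
    finally have "measure M B / 4 \<le> (C + \<Phi>) / l powr p"
      using l0 C\<Phi> by (simp add: pos_le_divide_eq)
    moreover have "2 * measure M (F l) \<le> measure M B / 4"
      using F_small[OF 0(1)] sX by linarith
    ultimately have "2 * measure M (F l) \<le> (C + \<Phi>) / l powr p" by (rule order_trans[rotated])
    then show ?case
      by (rule packing_bound_mono[OF stopping_packing_initial[OF F_fm] order_refl])
  next
    case (Suc n)
    have l0: "0 < l" using Suc.prems L by linarith
    show ?case
    proof (cases "l \<le> 4 * L * K ^ Suc n")
      case True
      then show ?thesis using Suc by blast
    next
      case False
      \<comment> \<open>One step from \<open>l / K\<close>; the quarter of the old bound and the new mass \<open>\<Phi> / 4\<close> add up to at most half of \<open>C + \<Phi>\<close>, and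
        \<open>K powr p = 2\<close> supplies the other factor.\<close>
      define l' where "l' = l / K"
      have lK: "l = K * l'" using K by (simp add: l'_def)
      have l'0: "0 < l'" using l0 K by (simp add: l'_def)
      have "4 * L * K \<le> 4 * L * K ^ Suc n"
        using K L by (intro mult_left_mono) auto
      then have "4 * L * K \<le> l" using False by linarith
      then have lower: "4 * L \<le> l'" using K by (simp add: l'_def field_simps)
      have "l' \<le> 4 * L * K ^ Suc n" using Suc.prems(2) K by (simp add: l'_def field_simps)
      from step[OF lower Suc.IH[OF lower this]]
      have "packing_bound M R (stopping M R B (F l))
          ((C + \<Phi>) / l' powr p / 4 + c\<^sup>2 * (N / (d * l') powr p))" by (simp add: lK)
      then show ?thesis
      proof (rule packing_bound_mono[OF _ order_refl])
        show "(C + \<Phi>) / l' powr p / 4 + c\<^sup>2 * (N / (d * l') powr p) \<le> (C + \<Phi>) / l powr p"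
        proof -
          have "(C + \<Phi>) / l' powr p / 4 + c\<^sup>2 * (N / (d * l') powr p) = ((C + 2 * \<Phi>) / 4) / l' powr p"
            using d l'0 by (simp add: \<Phi>_def powr_mult field_simps)
          also have "\<dots> \<le> ((C + \<Phi>) / 2) / l' powr p" using C\<Phi> by (intro divide_right_mono) auto
          also have "\<dots> = (C + \<Phi>) / l powr p" using K l'0 Kp by (simp add: lK powr_mult)
          finally show ?thesis .
        qed
      qed
    qed
  qed
  note decay = this
  define P where "P = (2::real) powr p"
  define E where "E = (K - 1) powr p"
  have P0: "0 < P" by (simp add: P_def)
  have E0: "0 < E" using K by (simp add: E_def)
  have PE: "P \<le> 4 / E"
    using shifted_root_powr_le_4[OF p] E0 by (simp add: P_def E_def K_def pos_le_divide_eq)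
  have tp: "0 < t powr p" using t by simp
  have c4: "1 \<le> c ^ 4" "c\<^sup>2 \<le> c ^ 4" using c_gt_1 by (auto intro!: one_le_power power_increasing)
  have const: "2 powr (p + 3) * c ^ 4 / (2 powr (1 / p) - 1) powr p * (N / t powr p) = 8 * P * c ^ 4 / E * N / t powr p"
    by (simp add: P_def E_def K_def powr_add)
  have "measure M {x \<in> B. \<bar>f x - ereal m\<bar> > ereal t} \<le> 8 * P * c ^ 4 / E * N / t powr p"
  proof (cases "4 * L \<le> t")
    case True
    obtain n where "t / (4 * L) < K ^ n" using real_arch_pow[OF K] by blast
    then have "t \<le> 4 * L * K ^ n" using L by (simp add: field_simps)
    also have "\<dots> \<le> 4 * L * K ^ Suc n" using L K by (intro mult_left_mono power_increasing) auto
    finally have "t \<le> 4 * L * K ^ Suc n" .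
    note bound = decay[OF True this]
    have "F t \<subseteq> ball x\<^sub>0 ((1 + h) * \<rho>)" by (auto simp: F_def X_def)
    then have "measure M (F t \<inter> B) \<le> c\<^sup>2 * ((C + \<Phi>) / t powr p)"
      by (rule measure_le_stopping_packing[OF F_sets _ R XB(4) bound])
    also have "F t \<inter> B = {x \<in> B. \<bar>f x - ereal m\<bar> > ereal t}" using BX by (auto simp: F_def)
    finally have "measure M {x \<in> B. \<bar>f x - ereal m\<bar> > ereal t} \<le> c\<^sup>2 * (C + \<Phi>) / t powr p" by simp
    also have "\<dots> \<le> 8 * P * c ^ 4 / E * N / t powr p"
    proof (rule divide_right_mono)
      have "P * P \<le> P * (4 / E)" using PE P0 by (intro mult_left_mono) auto
      then have "P * P * (N / 2) \<le> P * (4 / E) * (N / 2)" using N0 by (intro mult_right_mono) auto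
      then have "C \<le> 2 * P / E * N" by (simp add: C_def P_def[symmetric] mult_ac)
      moreover have "\<Phi> = 4 * c\<^sup>2 * P / E * N"
        using K by (simp add: \<Phi>_def d_def powr_divide P_def E_def)
      ultimately have "c\<^sup>2 * (C + \<Phi>) \<le> c\<^sup>2 * (2 * P / E * N + 4 * c\<^sup>2 * P / E * N)"
        by (intro mult_left_mono add_mono) auto
      also have "\<dots> = (2 * c\<^sup>2 + 4 * c ^ 4) * (P / E * N)" by (simp add: algebra_simps power2_eq_square power4_eq_xxxx)
      also have "\<dots> \<le> (8 * c ^ 4) * (P / E * N)" using c4 P0 E0 N0 by (intro mult_right_mono) auto
      finally show "c\<^sup>2 * (C + \<Phi>) \<le> 8 * P * c ^ 4 / E * N" by (simp add: mult_ac)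
    qed simp
    finally show ?thesis .
  next
    case False
    have "measure M {x \<in> B. \<bar>f x - ereal m\<bar> > ereal t} \<le> measure M B"
      using XB BX by (intro measure_mono_fmeasurable dev_meas) auto
    also have "\<dots> = P * P * N / (4 * L) powr p"
    proof -
      have "4 powr p = P * P" by (simp add: P_def flip: powr_mult)
      then have "(4 * L) powr p = P * P * L powr p" by (simp only: powr_mult)
      then show ?thesis using Lp N0 Bpos P0 by simp
    qed
    also have "\<dots> \<le> P * P * N / t powr p"
      using False t L p P0 N0 by (intro divide_left_mono powr_mono2) auto
    also have "\<dots> \<le> 8 * P * c ^ 4 / E * N / t powr p"
    proof (intro divide_right_mono mult_right_mono)
      have "P * P \<le> P * (4 / E)" using PE P0 by (intro mult_left_mono) auto
      also have "\<dots> = 4 * (P / E)" by simp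
      also have "\<dots> \<le> (8 * c ^ 4) * (P / E)" using c4 P0 E0 by (intro mult_right_mono) auto
      finally show "P * P \<le> 8 * P * c ^ 4 / E" by (simp add: mult_ac)
    qed (use N0 in auto)
    finally show ?thesis .
  qed
  then show thesis using that[of m] m(1) unfolding const B_def by blast
qed

end

theorem theorem4p4:
  fixes M :: "'a::metric_space measure"
    and f :: "'a \<Rightarrow> ereal"
    and c\<^sub>\<mu> D p \<eta> \<alpha> s r t r\<^sub>0 :: real
    and x\<^sub>0 :: 'a
  assumes "borel_regular M"
    and "doubling M c\<^sub>\<mu>"
    and "D = log 2 c\<^sub>\<mu>"
    and "1 < p"
    and "0 < \<eta>"
    and "0 < r\<^sub>0"
    and "\<alpha> = 5 powr D * c\<^sub>\<mu> ^ 2 * (1 + 1 / \<eta>) powr D"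
    and "0 < s"
    and "s \<le> min (1 / (2 * \<alpha>)) (1 / (8 * c\<^sub>\<mu> ^ 3))"
    and "s \<le> r"
    and "r \<le> 1 / 2"
    and "f \<in> JN_space M p s (ball x\<^sub>0 ((1 + \<eta>) * r\<^sub>0))"
    and "0 < t"
  shows "emeasure M {x \<in> ball x\<^sub>0 r\<^sub>0.
             \<bar>f x - max_median M r f (ball x\<^sub>0 r\<^sub>0)\<bar> > ereal t}
         \<le> ennreal (2 powr (p + 3) * c\<^sub>\<mu> ^ 6 / (2 powr (1 / p) - 1) powr p
             * (JN_norm M p s (ball x\<^sub>0 ((1 + \<eta>) * r\<^sub>0)) f powr p / t powr p))"
proof -
  interpret doubling_measure M c\<^sub>\<mu> using assms(1,2) by unfold_locales
  define \<Omega> where "\<Omega> = ball x\<^sub>0 ((1 + \<eta>) * r\<^sub>0)"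
  define h where "h = min \<eta> 1"
  define N\<^sub>0 where "N\<^sub>0 = enn2real (JN_sup M p s \<Omega> f)"
  have h: "0 < h" "h \<le> 1" "h \<le> \<eta>" using assms(5) by (auto simp: h_def)
  have f: "f \<in> borel_measurable (restrict_space M \<Omega>)" and fin: "JN_sup M p s \<Omega> f < \<infinity>"
    using assms(12) by (auto simp: JN_space_def \<Omega>_def)
  have sub: "ball x\<^sub>0 ((1 + h) * r\<^sub>0) \<subseteq> \<Omega>"
    unfolding \<Omega>_def using h assms(6) by (intro subset_ball mult_right_mono) auto
  have s\<alpha>: "s \<le> 1 / (2 * (5 powr D * c\<^sub>\<mu> ^ 2 * (1 + 1 / \<eta>) powr D))" "s \<le> 1 / (8 * c\<^sub>\<mu> ^ 3)"
    using assms(7,9) by auto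
  obtain j where j: "4 + 2 * h \<le> 2 ^ j * h" "s * c\<^sub>\<mu> ^ j \<le> 1 / 2"
    using doubling_exponent_choice[OF c_gt_1 assms(3,5,8) s\<alpha>] unfolding h_def .
  have s3: "s * c\<^sub>\<mu> ^ 3 \<le> 1 / 8" using s\<alpha>(2) c_gt_1 by (simp add: field_simps)
  define Q where "Q = 2 powr (p + 3) * c\<^sub>\<mu> ^ 4 / (2 powr (1 / p) - 1) powr p / t powr p"
  have "1 < 2 powr (1 / p)" using assms(4) by simp
  then have Q: "0 < Q"
    using c_gt_1 assms(13) unfolding Q_def by (intro divide_pos_pos mult_pos_pos) auto
  let ?m = "max_median M r f (ball x\<^sub>0 r\<^sub>0)"
  let ?D = "{x \<in> ball x\<^sub>0 r\<^sub>0. \<bar>f x - ?m\<bar> > ereal t}"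
  \<comment> \<open>The bound holds for every \<open>N\<close> above the functional, hence in the limit.\<close>
  have each: "measure M ?D / Q \<le> N \<and> (\<exists>m. ?m = ereal m)" if N: "N\<^sub>0 < N" for N
  proof -
    obtain m where m: "?m = ereal m" "measure M {x \<in> ball x\<^sub>0 r\<^sub>0. \<bar>f x - ereal m\<bar> > ereal t} \<le>
       2 powr (p + 3) * c\<^sub>\<mu> ^ 4 / (2 powr (1 / p) - 1) powr p * (N / t powr p)"
      using JN_weak_type[OF assms(4,8) h(1,2) assms(6) f _ sub fin N[unfolded N\<^sub>0_def] j s3 assms(10,11,13)]
      by (auto simp: \<Omega>_def)
    have "measure M ?D \<le> Q * N" using m(2) unfolding m(1) Q_def by (simp add: mult_ac)
    then show ?thesis using Q m(1) by (auto simp: field_simps)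
  qed
  have le: "measure M ?D \<le> Q * N\<^sub>0"
    using dense_ge[of N\<^sub>0 "measure M ?D / Q"] each Q by (simp add: field_simps)
  obtain m where m: "?m = ereal m" using each[OF less_add_one] by blast
  have B\<Omega>: "ball x\<^sub>0 r\<^sub>0 \<subseteq> \<Omega>"
    unfolding \<Omega>_def using assms(5,6) by (intro subset_ball) (simp add: algebra_simps)
  have "?D \<in> sets M"
    unfolding m by (rule deviation_set_measurable[OF f _ _ B\<Omega>]) (auto simp: \<Omega>_def)
  then have "?D \<in> fmeasurable M" by (intro fmeasurableI2[OF ball_fmeasurable[of x\<^sub>0 r\<^sub>0]]) auto
  then have "emeasure M ?D = ennreal (measure M ?D)" by (rule emeasure_eq_measure2)
  also have "\<dots> \<le> ennreal (2 powr (p + 3) * c\<^sub>\<mu> ^ 6 / (2 powr (1 / p) - 1) powr p * (N\<^sub>0 / t powr p))"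
  proof (rule ennreal_leI)
    have "N\<^sub>0 \<ge> 0" by (simp add: N\<^sub>0_def)
    have "Q * N\<^sub>0 = 2 powr (p + 3) * c\<^sub>\<mu> ^ 4 / (2 powr (1 / p) - 1) powr p * (N\<^sub>0 / t powr p)"
      by (simp add: Q_def)
    also have "\<dots> \<le> 2 powr (p + 3) * c\<^sub>\<mu> ^ 6 / (2 powr (1 / p) - 1) powr p * (N\<^sub>0 / t powr p)"
      using c_gt_1 \<open>N\<^sub>0 \<ge> 0\<close> by (intro mult_right_mono divide_right_mono mult_left_mono power_increasing) auto
    finally show "measure M ?D \<le> 2 powr (p + 3) * c\<^sub>\<mu> ^ 6 / (2 powr (1 / p) - 1) powr p * (N\<^sub>0 / t powr p)"
      using le by linarith
  qed
  also have "N\<^sub>0 = JN_norm M p s \<Omega> f powr p"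
    using assms(4) by (simp add: JN_norm_def N\<^sub>0_def powr_powr)
  finally show ?thesis by (simp only: \<Omega>_def)
qed

end
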